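(* Let $G=\mathbb{Z}_2$ act freely on a finitistic space $X$ with $X\sim_2\mathbb{S}^n\times\mathbb{S}^m\times\mathbb{S}^l$, $1\le n\le m\le l$. Then there does not exist a $G$-equivariant map from $\mathbb{S}^d$ to $X$ for $d>h$, where $h$ is one of $n,\ m,\ l,\ n+m,\ 2n+l,\ n+l,\ m+l$ or $n+m+l$.
   Context: $\mathbb{S}^d$ is equipped with the antipodal action of $\mathbb{Z}_2$. $H^*(-)$ denotes Čech cohomology with coefficients in $\mathbb{Z}_2$, and $X\sim_2 Y$ means $H^*(X;\mathbb{Z}_2)\cong H^*(Y;\mathbb{Z}_2)$ as graded rings. A paracompact Hausdorff space is finitistic if every open covering has a finite-dimensional open refinement. The value of $h$ (in the listed set) depends on the $G$-space $X$. *)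

theory Defs
  imports "HOL-Homology.Homology" "HOL-Algebra.Group_Action" "HOL-Library.Z2"
begin

section \<open>Open covers and finitistic spaces\<close>

definition open_cover :: "'a topology \<Rightarrow> 'a set set \<Rightarrow> bool" where
  "open_cover X \<U> \<longleftrightarrow> (\<forall>U\<in>\<U>. openin X U) \<and> \<Union>\<U> = topspace X"

definition refines :: "'a set set \<Rightarrow> 'a set set \<Rightarrow> bool" where
  "refines \<V> \<U> \<longleftrightarrow> (\<forall>V\<in>\<V>. \<exists>U\<in>\<U>. V \<subseteq> U)"

definition paracompact_space :: "'a topology \<Rightarrow> bool" where
  "paracompact_space X \<longleftrightarrow>
     (\<forall>\<U>. open_cover X \<U> \<longrightarrow>
        (\<exists>\<V>. open_cover X \<V> \<and> refines \<V> \<U> \<and> locally_finite_in X \<V>))"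

text \<open>The dimension of a cover is that of its nerve: dimension at most \<open>N\<close> means that at most
  \<open>N + 1\<close> distinct members have a common point.\<close>

definition finite_dimensional_cover :: "'a set set \<Rightarrow> bool" where
  "finite_dimensional_cover \<U> \<longleftrightarrow>
     (\<exists>N. \<forall>F. F \<subseteq> \<U> \<and> finite F \<and> F \<noteq> {} \<and> \<Inter>F \<noteq> {} \<longrightarrow> card F \<le> Suc N)"

definition finitistic_space :: "'a topology \<Rightarrow> bool" where
  "finitistic_space X \<longleftrightarrow>
     paracompact_space X \<and> Hausdorff_space X \<and>
     (\<forall>\<U>. open_cover X \<U> \<longrightarrow>
        (\<exists>\<V>. open_cover X \<V> \<and> refines \<V> \<U> \<and> finite_dimensional_cover \<V>))"


section \<open>Cech cohomology with coefficients in the field of two elements\<close>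

text \<open>Cochains on the nerve of a cover are taken on ordered simplices, that is, on tuples of members
  (repetitions allowed) with a common point. A cochain is a function on all lists that
  vanishes outside the \<open>k\<close>-simplices, so that equality of cochains is equality of functions.
  No signs are needed in characteristic two.\<close>

definition nerve_simplices :: "'a set set \<Rightarrow> nat \<Rightarrow> 'a set list set" where
  "nerve_simplices \<U> k = {\<sigma>. length \<sigma> = Suc k \<and> set \<sigma> \<subseteq> \<U> \<and> \<Inter>(set \<sigma>) \<noteq> {}}"

type_synonym 'a cochain = "'a set list \<Rightarrow> bit"

definition cochains :: "'a set set \<Rightarrow> nat \<Rightarrow> 'a cochain set" where
  "cochains \<U> k = {c. \<forall>\<sigma>. \<sigma> \<notin> nerve_simplices \<U> k \<longrightarrow> c \<sigma> = 0}"

definition coboundary :: "'a set set \<Rightarrow> nat \<Rightarrow> 'a cochain \<Rightarrow> 'a cochain" where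
  "coboundary \<U> k c =
     (\<lambda>\<sigma>. if \<sigma> \<in> nerve_simplices \<U> (Suc k)
          then \<Sum>i\<le>Suc k. c (take i \<sigma> @ drop (Suc i) \<sigma>) else 0)"

definition cocycles :: "'a set set \<Rightarrow> nat \<Rightarrow> 'a cochain set" where
  "cocycles \<U> k = {c \<in> cochains \<U> k. coboundary \<U> k c = (\<lambda>\<sigma>. 0)}"

definition coboundaries :: "'a set set \<Rightarrow> nat \<Rightarrow> 'a cochain set" where
  "coboundaries \<U> k =
     (case k of 0 \<Rightarrow> {\<lambda>\<sigma>. 0} | Suc j \<Rightarrow> coboundary \<U> j ` cochains \<U> j)"

definition cochain_add :: "'a cochain \<Rightarrow> 'a cochain \<Rightarrow> 'a cochain" where
  "cochain_add c d = (\<lambda>\<sigma>. c \<sigma> + d \<sigma>)"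

definition cochain_one :: "'a set set \<Rightarrow> 'a cochain" where
  "cochain_one \<U> = (\<lambda>\<sigma>. if \<sigma> \<in> nerve_simplices \<U> 0 then 1 else 0)"

text \<open>Alexander-Whitney formula: front \<open>j\<close>-face times back \<open>k\<close>-face, sharing vertex \<open>j\<close>.\<close>

definition cochain_cup :: "'a set set \<Rightarrow> nat \<Rightarrow> nat \<Rightarrow> 'a cochain \<Rightarrow> 'a cochain \<Rightarrow> 'a cochain" where
  "cochain_cup \<U> j k c d =
     (\<lambda>\<sigma>. if \<sigma> \<in> nerve_simplices \<U> (j + k) then c (take (Suc j) \<sigma>) * d (drop j \<sigma>) else 0)"

definition refinement_map :: "'a set set \<Rightarrow> 'a set set \<Rightarrow> ('a set \<Rightarrow> 'a set) \<Rightarrow> bool" where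
  "refinement_map \<V> \<U> p \<longleftrightarrow> (\<forall>V\<in>\<V>. p V \<in> \<U> \<and> V \<subseteq> p V)"

definition cochain_pullback :: "'a set set \<Rightarrow> nat \<Rightarrow> ('a set \<Rightarrow> 'a set) \<Rightarrow> 'a cochain \<Rightarrow> 'a cochain" where
  "cochain_pullback \<V> k p c = (\<lambda>\<sigma>. if \<sigma> \<in> nerve_simplices \<V> k then c (map p \<sigma>) else 0)"

text \<open>The direct limit, over all open covers ordered by refinement, of the cohomology of the nerves:
  a class is represented by a cover together with a cocycle on its nerve, and two representatives
  are identified iff they become cohomologous on some common refinement. The sum of two cochains
  is also their difference.\<close>

definition cech_reps :: "'a topology \<Rightarrow> nat \<Rightarrow> ('a set set \<times> 'a cochain) set" where
  "cech_reps X k = {(\<U>, c). open_cover X \<U> \<and> c \<in> cocycles \<U> k}"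

definition cech_rel ::
    "'a topology \<Rightarrow> nat \<Rightarrow> (('a set set \<times> 'a cochain) \<times> ('a set set \<times> 'a cochain)) set" where
  "cech_rel X k =
     {((\<U>, c), (\<V>, d)). (\<U>, c) \<in> cech_reps X k \<and> (\<V>, d) \<in> cech_reps X k \<and>
        (\<exists>\<W> p q. open_cover X \<W> \<and> refinement_map \<W> \<U> p \<and> refinement_map \<W> \<V> q \<and>
           cochain_add (cochain_pullback \<W> k p c) (cochain_pullback \<W> k q d) \<in> coboundaries \<W> k)}"

type_synonym 'a cech_class = "('a set set \<times> 'a cochain) set"

definition cech_cohomology :: "'a topology \<Rightarrow> nat \<Rightarrow> 'a cech_class set" where
  "cech_cohomology X k = cech_reps X k // cech_rel X k"

definition cech_class_of :: "'a topology \<Rightarrow> nat \<Rightarrow> 'a set set \<Rightarrow> 'a cochain \<Rightarrow> 'a cech_class" where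
  "cech_class_of X k \<U> c = cech_rel X k `` {(\<U>, c)}"

text \<open>Two classes always have representatives on one common cover; the unions below run over all
  such choices, which all give the same class.\<close>

definition cech_add :: "'a topology \<Rightarrow> nat \<Rightarrow> 'a cech_class \<Rightarrow> 'a cech_class \<Rightarrow> 'a cech_class" where
  "cech_add X k a b =
     \<Union>{cech_class_of X k \<U> (cochain_add c d) | \<U> c d. (\<U>, c) \<in> a \<and> (\<U>, d) \<in> b}"

definition cech_cup ::
    "'a topology \<Rightarrow> nat \<Rightarrow> nat \<Rightarrow> 'a cech_class \<Rightarrow> 'a cech_class \<Rightarrow> 'a cech_class" where
  "cech_cup X j k a b =
     \<Union>{cech_class_of X (j + k) \<U> (cochain_cup \<U> j k c d) | \<U> c d. (\<U>, c) \<in> a \<and> (\<U>, d) \<in> b}"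

definition cech_one :: "'a topology \<Rightarrow> 'a cech_class" where
  "cech_one X = cech_class_of X 0 {topspace X} (cochain_one {topspace X})"

definition cech_group :: "'a topology \<Rightarrow> nat \<Rightarrow> 'a cech_class monoid" where
  "cech_group X k =
     \<lparr>carrier = cech_cohomology X k, monoid.mult = cech_add X k,
      one = cech_class_of X k {topspace X} (\<lambda>\<sigma>. 0)\<rparr>"

text \<open>A graded ring isomorphism, given by its homogeneous components.\<close>

definition cech_graded_ring_iso ::
    "'a topology \<Rightarrow> 'b topology \<Rightarrow> (nat \<Rightarrow> 'a cech_class \<Rightarrow> 'b cech_class) \<Rightarrow> bool" where
  "cech_graded_ring_iso X Y \<Phi> \<longleftrightarrow>
     (\<forall>k. \<Phi> k \<in> iso (cech_group X k) (cech_group Y k)) \<and>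
     (\<forall>j k. \<forall>a\<in>cech_cohomology X j. \<forall>b\<in>cech_cohomology X k.
        \<Phi> (j + k) (cech_cup X j k a b) = cech_cup Y j k (\<Phi> j a) (\<Phi> k b)) \<and>
     \<Phi> 0 (cech_one X) = cech_one Y"

definition cech_equivalent :: "'a topology \<Rightarrow> 'b topology \<Rightarrow> bool" (infix \<open>\<sim>\<^sub>2\<close> 50) where
  "X \<sim>\<^sub>2 Y \<longleftrightarrow> (\<exists>\<Phi>. cech_graded_ring_iso X Y \<Phi>)"


section \<open>Actions of discrete groups\<close>

definition continuous_action ::
    "('g, 'm) monoid_scheme \<Rightarrow> 'a topology \<Rightarrow> ('g \<Rightarrow> 'a \<Rightarrow> 'a) \<Rightarrow> bool" where
  "continuous_action G X \<phi> \<longleftrightarrow>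
     group_action G (topspace X) \<phi> \<and> (\<forall>g\<in>carrier G. continuous_map X X (\<phi> g))"

definition free_continuous_action ::
    "('g, 'm) monoid_scheme \<Rightarrow> 'a topology \<Rightarrow> ('g \<Rightarrow> 'a \<Rightarrow> 'a) \<Rightarrow> bool" where
  "free_continuous_action G X \<phi> \<longleftrightarrow>
     continuous_action G X \<phi> \<and>
     (\<forall>g\<in>carrier G. \<forall>x\<in>topspace X. \<phi> g x = x \<longrightarrow> g = \<one>\<^bsub>G\<^esub>)"

definition equivariant_map ::
    "('g, 'm) monoid_scheme \<Rightarrow> 'a topology \<Rightarrow> ('g \<Rightarrow> 'a \<Rightarrow> 'a) \<Rightarrow>
     'b topology \<Rightarrow> ('g \<Rightarrow> 'b \<Rightarrow> 'b) \<Rightarrow> ('a \<Rightarrow> 'b) \<Rightarrow> bool" where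
  "equivariant_map G X \<phi> Y \<psi> f \<longleftrightarrow>
     continuous_map X Y f \<and>
     (\<forall>g\<in>carrier G. \<forall>x\<in>topspace X. f (\<phi> g x) = \<psi> g (f x))"

text \<open>The restriction is needed because the bijections in \<^const>\<open>BijGroup\<close> are extensional.\<close>

definition antipodal_action :: "nat \<Rightarrow> int \<Rightarrow> (nat \<Rightarrow> real) \<Rightarrow> (nat \<Rightarrow> real)" where
  "antipodal_action d g =
     (\<lambda>x\<in>topspace (nsphere d). if g = 0 then x else (\<lambda>i. - x i))"

lemma topspace_nsphere_iff:
  "x \<in> topspace (nsphere d) \<longleftrightarrow> (\<Sum>i\<le>d. x i ^ 2) = 1 \<and> (\<forall>i>d. x i = 0)"
  by (auto simp: nsphere)

lemma continuous_map_antipodal_action: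
  "continuous_map (nsphere d) (nsphere d) (antipodal_action d g)"
proof -
  have "continuous_map (nsphere d) (nsphere d) (\<lambda>x i. - x i)"
    unfolding nsphere continuous_map_in_subtopology continuous_map_componentwise_UNIV
    by (auto intro!: continuous_map_from_subtopology continuous_map_minus
        continuous_map_product_projection)
  then have "continuous_map (nsphere d) (nsphere d) (\<lambda>x. if g = 0 then x else (\<lambda>i. - x i))"
    by (cases "g = 0") auto
  then show ?thesis
    unfolding antipodal_action_def by (rule continuous_map_eq) auto
qed

lemma free_antipodal_action:
  "free_continuous_action (integer_mod_group 2) (nsphere d) (antipodal_action d)"
proof -
  let ?S = "topspace (nsphere d)"
  have neg: "(\<lambda>i. - x i) \<in> ?S" if "x \<in> ?S" for x
    using that by (simp add: topspace_nsphere_iff)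
  have inv: "antipodal_action d g x \<in> ?S" "antipodal_action d g (antipodal_action d g x) = x"
    if "x \<in> ?S" for g x
    using that neg by (auto simp: antipodal_action_def)
  have bij: "antipodal_action d g \<in> Bij ?S" for g
    unfolding Bij_def
    by (auto simp: inv intro!: bij_betw_byWitness[where f' = "antipodal_action d g"])
      (simp add: antipodal_action_def)
  have mult: "antipodal_action d ((g + h) mod 2) =
      compose ?S (antipodal_action d g) (antipodal_action d h)"
    if "g \<in> {0..<2}" "h \<in> {0..<2}" for g h
  proof -
    have "g = 0 \<or> g = 1" "h = 0 \<or> h = 1"
      using that by auto
    then show ?thesis
      by (auto simp: antipodal_action_def compose_def neg fun_eq_iff)
  qed
  have "group_action (integer_mod_group 2) ?S (antipodal_action d)"
    unfolding group_action_def group_hom_def group_hom_axioms_def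
    by (intro conjI group_BijGroup)
      (auto simp: hom_def carrier_integer_mod_group BijGroup_def bij mult)
  moreover have "g = 0" if "x \<in> ?S" "antipodal_action d g x = x" for g x
  proof (rule ccontr)
    assume "g \<noteq> 0"
    with that have "(\<lambda>i. - x i) = x"
      by (simp add: antipodal_action_def)
    then have "x i = 0" for i
      by (metis neg_equal_zero)
    with that show False
      by (simp add: topspace_nsphere_iff)
  qed
  ultimately show ?thesis
    by (auto simp: free_continuous_action_def continuous_action_def
        continuous_map_antipodal_action)
qed

end

theory Submission
  imports Defs "HOL-Library.Multiset"
begin

text \<open>The largest of the listed numbers, \<open>N = n + m + l\<close>, serves as \<open>h\<close>, and of the
  cohomology of \<open>X\<close> only the vanishing above degree \<open>N\<close> matters.

  Let \<open>t\<close> be the free involution and let \<open>w\<close> be the characteristic class in degree one of the double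
  cover of the orbit space. Invariant cochains on covers by small open sets compute the cohomology of
  the orbit space, and for them there is the exact transfer sequence given by \<open>1 + t\<close>, whose connecting
  homomorphism is multiplication by \<open>w\<close>. Above degree \<open>N\<close> the cohomology of \<open>X\<close> is zero, so
  multiplication by \<open>w\<close> is injective there. Since \<open>X\<close> is finitistic, \<open>w\<close> comes from a
  finite-dimensional nerve, hence some power of \<open>w\<close> vanishes; descending by injectivity, all powers
  \<open>w\<^sup>d\<close> with \<open>d > N\<close> vanish (\<open>char_power_vanishes_above\<close>). An equivariant map from the sphere of
  dimension \<open>d\<close> would pull this back to the vanishing of the top power of \<open>w\<close> on the projective space,
  which is impossible (\<open>no_equivariant_map_if_char_power_vanishes\<close>).

  All of this is done on cochains of nerves of invariant covers; no cohomology of the orbit space is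
  formed. The powers of \<open>w\<close> are represented by cochains obtained by iterating the connecting
  homomorphism (\<open>char_cochain\<close>), which is a notion stable under equivariant refinement.

  Two kinds of comparison of simplicial chain maps are needed: two refinement maps are homotopic, and
  the ordered cochains of a complex of dimension \<open>N\<close> are cohomologically trivial above \<open>N\<close> although
  there are degenerate simplices of every length. Both are instances of one explicit acyclic carrier
  homotopy, built by coning (\<open>cone_homotopy\<close>). The second one is applied twice: to the finitistic space,
  equivariantly, and to the product of spheres, whose covering dimension is at most \<open>N\<close>
  (\<open>low_order_refinement\<close>), so that its Cech cohomology vanishes above \<open>N\<close>
  (\<open>cech_vanishes_product_of_spheres\<close>).

  For the sphere, singular chains of hemispheres are chosen with the boundary of each the sum of the
  previous one and its antipode, up to sign. After subdivision until every simplex is small they map to the nerve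
  and pair to one with the cochains that represent the powers of \<open>w\<close>; but the
  coboundary of an invariant cochain pairs to zero with them.\<close>

section \<open>Cochains on ordered simplices\<close>

text \<open>Addition and multiplication modulo two are to be simplified by the ring laws; by default they would
  be rewritten into logical operations.\<close>

declare add_bit_eq_xor [simp del] mult_bit_eq_and [simp del]

lemma bit_add_same [simp]: "(b::bit) + b = 0"
  by (cases b) auto

lemma bit_add_same_left [simp]: "(b::bit) + (b + c) = c"
  by (cases b; cases c) auto

lemma bit_add_eq_0_iff: "(b::bit) + c = 0 \<longleftrightarrow> b = c"
  by (cases b; cases c) auto

text \<open>A list of vertices stands for an ordered simplex, its dimension being one less than its length; the
  empty list is the simplex of dimension \<open>-1\<close>, so that the complexes below are augmented. With this
  convention the boundary of a cone is the base plus the cone over the boundary in all dimensions. A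
  list of lists is a chain with coefficients modulo two, in which repeated entries cancel only after
  evaluation.\<close>

primrec faces :: "'v list \<Rightarrow> 'v list list" where
  "faces [] = []"
| "faces (v # \<sigma>) = \<sigma> # map (Cons v) (faces \<sigma>)"

definition evaluate :: "('v list \<Rightarrow> bit) \<Rightarrow> 'v list list \<Rightarrow> bit" where
  "evaluate c x = sum_list (map c x)"

text \<open>The coboundary, on functions of arbitrary lists; complexes enter only as the sets of lists on which
  identities are asserted.\<close>

definition cobd :: "('v list \<Rightarrow> bit) \<Rightarrow> 'v list \<Rightarrow> bit" where
  "cobd c \<sigma> = evaluate c (faces \<sigma>)"

lemma evaluate_simps [simp]:
  "evaluate c [] = 0" "evaluate c (\<sigma> # x) = c \<sigma> + evaluate c x" "evaluate c (x @ y) = evaluate c x + evaluate c y"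
  by (auto simp: evaluate_def add.assoc)

lemma evaluate_map: "evaluate c (map f x) = evaluate (\<lambda>\<sigma>. c (f \<sigma>)) x"
  by (simp add: evaluate_def o_def)

lemma evaluate_concat_map: "evaluate c (concat (map f x)) = evaluate (\<lambda>\<sigma>. evaluate c (f \<sigma>)) x"
  by (induction x) auto

lemma evaluate_add: "evaluate (\<lambda>\<sigma>. c \<sigma> + d \<sigma>) x = evaluate c x + evaluate d x"
  by (simp add: evaluate_def sum_list_addf)

lemma evaluate_cong: "(\<And>\<sigma>. \<sigma> \<in> set x \<Longrightarrow> c \<sigma> = d \<sigma>) \<Longrightarrow> evaluate c x = evaluate d x"
  unfolding evaluate_def by (metis (mono_tags, lifting) map_eq_conv)

lemma evaluate_zero [simp]: "evaluate (\<lambda>_. 0) x = 0"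
  by (induction x) auto

lemma cobd_Nil [simp]: "cobd c [] = 0"
  by (simp add: cobd_def)

lemma cobd_Cons: "cobd c (v # \<sigma>) = c \<sigma> + cobd (\<lambda>\<rho>. c (v # \<rho>)) \<sigma>"
  by (simp add: cobd_def evaluate_map)

lemma cobd_add: "cobd (\<lambda>\<sigma>. c \<sigma> + d \<sigma>) \<sigma> = cobd c \<sigma> + cobd d \<sigma>"
  by (simp add: cobd_def evaluate_add)

lemma cobd_cobd [simp]: "cobd (cobd c) \<sigma> = 0"
proof (induction \<sigma> arbitrary: c)
  case (Cons v \<sigma>)
  have "(\<lambda>\<rho>. cobd c (v # \<rho>)) = (\<lambda>\<rho>. c \<rho> + cobd (\<lambda>\<rho>. c (v # \<rho>)) \<rho>)"
    by (simp add: cobd_Cons)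
  then show ?case
    by (simp add: cobd_Cons cobd_add Cons.IH)
qed auto

lemma length_faces: "\<rho> \<in> set (faces \<sigma>) \<Longrightarrow> Suc (length \<rho>) = length \<sigma>"
  by (induction \<sigma> arbitrary: \<rho>) auto

lemma set_faces: "\<rho> \<in> set (faces \<sigma>) \<Longrightarrow> set \<rho> \<subseteq> set \<sigma>"
  by (induction \<sigma> arbitrary: \<rho>) fastforce+

lemma faces_map: "faces (map f \<sigma>) = map (map f) (faces \<sigma>)"
  by (induction \<sigma>) auto

lemma cobd_map: "cobd c (map f \<sigma>) = cobd (\<lambda>\<rho>. c (map f \<rho>)) \<sigma>"
  by (simp add: cobd_def faces_map evaluate_map)

lemma faces_conv_nth:
  "faces \<sigma> = map (\<lambda>i. take i \<sigma> @ drop (Suc i) \<sigma>) [0..<length \<sigma>]"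
proof (induction \<sigma>)
  case (Cons v \<sigma>)
  have "map (\<lambda>i. take i (v # \<sigma>) @ drop (Suc i) (v # \<sigma>)) [Suc 0..<Suc (length \<sigma>)] =
    map (Cons v) (map (\<lambda>i. take i \<sigma> @ drop (Suc i) \<sigma>) [0..<length \<sigma>])"
    by (simp add: map_Suc_upt[symmetric] del: upt_Suc)
  then show ?case
    by (simp add: Cons.IH upt_conv_Cons del: upt_Suc map_map)
qed auto

text \<open>The bridge to coboundaries written as a sum over positions.\<close>

lemma cobd_conv_sum:
  "cobd c \<sigma> = (\<Sum>i<length \<sigma>. c (take i \<sigma> @ drop (Suc i) \<sigma>))"
  by (simp add: cobd_def faces_conv_nth evaluate_map evaluate_def interv_sum_list_conv_sum_set_nat
      atLeast0LessThan)

section \<open>Chain homotopies with acyclic carriers\<close>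

definition ordered_complex :: "'v list set \<Rightarrow> bool" where
  "ordered_complex K \<longleftrightarrow> (\<forall>\<sigma>\<in>K. \<forall>\<rho>. set \<rho> \<subseteq> set \<sigma> \<longrightarrow> \<rho> \<in> K)"

lemma ordered_complexD: "ordered_complex K \<Longrightarrow> \<sigma> \<in> K \<Longrightarrow> set \<rho> \<subseteq> set \<sigma> \<Longrightarrow> \<rho> \<in> K"
  by (auto simp: ordered_complex_def)

lemma cobd_cong:
  "ordered_complex K \<Longrightarrow> \<sigma> \<in> K \<Longrightarrow>
    (\<And>\<rho>. \<rho> \<in> K \<Longrightarrow> Suc (length \<rho>) = length \<sigma> \<Longrightarrow> c \<rho> = d \<rho>) \<Longrightarrow> cobd c \<sigma> = cobd d \<sigma>"
  unfolding cobd_def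
  by (rule evaluate_cong) (meson length_faces ordered_complexD set_faces)

text \<open>The homotopy between chain maps \<open>A\<close> and \<open>B\<close> of the method of acyclic carriers: \<open>A\<close> plus \<open>B\<close> plus
  the homotopy on the boundary is a cycle, and it is filled by the cone whose apex is the image under
  \<open>f\<close> of the leading vertex. Choosing the apex by \<open>f\<close> makes the homotopy natural, in particular
  equivariant when \<open>A\<close>, \<open>B\<close> and \<open>f\<close> are.\<close>

function cone_homotopy ::
    "('v list \<Rightarrow> 'w list list) \<Rightarrow> ('v list \<Rightarrow> 'w list list) \<Rightarrow> ('v \<Rightarrow> 'w) \<Rightarrow> 'v list \<Rightarrow> 'w list list"
  where
  "cone_homotopy A B f \<sigma> =
    (if \<sigma> = [] then []
     else map (Cons (f (hd \<sigma>))) (A \<sigma> @ B \<sigma> @ concat (map (cone_homotopy A B f) (faces \<sigma>))))"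
  by auto
termination
  by (relation "measure (\<lambda>(A, B, f, \<sigma>). length \<sigma>)") (auto dest: length_faces)

declare cone_homotopy.simps [simp del]

text \<open>Chain maps are described by their effect on cochains, because chains are compared only
  through evaluation.\<close>

definition cochain_map_on :: "'v list set \<Rightarrow> ('v list \<Rightarrow> 'w list list) \<Rightarrow> bool" where
  "cochain_map_on K A \<longleftrightarrow>
    (\<forall>\<sigma>\<in>K. \<forall>c. evaluate (cobd c) (A \<sigma>) = cobd (\<lambda>\<rho>. evaluate c (A \<rho>)) \<sigma>)"

lemma cone_homotopy_Nil [simp]: "cone_homotopy A B f [] = []"
  by (simp add: cone_homotopy.simps)

lemma evaluate_cone_homotopy:
  assumes "\<sigma> \<noteq> []"
  shows "evaluate c (cone_homotopy A B f \<sigma>) =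
    (let c' = \<lambda>\<rho>. c (f (hd \<sigma>) # \<rho>)
     in evaluate c' (A \<sigma>) + evaluate c' (B \<sigma>) + cobd (\<lambda>\<rho>. evaluate c' (cone_homotopy A B f \<rho>)) \<sigma>)"
  using assms
  by (subst cone_homotopy.simps)
    (simp add: evaluate_map evaluate_concat_map cobd_def Let_def add.assoc)

text \<open>By induction on the length. Applying the formula to a cochain restricted to simplices with the apex
  in front, the coboundary splits into the cochain itself and the coboundary of the restriction; the
  contributions of the latter cancel by the induction hypothesis on the faces.\<close>

lemma cone_homotopy:
  assumes K: "ordered_complex K" and A: "cochain_map_on K A" and B: "cochain_map_on K B"
    and AB: "\<And>c. evaluate c (A []) = evaluate c (B [])"
    and "\<sigma> \<in> K"
  shows "evaluate (cobd c) (cone_homotopy A B f \<sigma>) =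
    evaluate c (A \<sigma>) + evaluate c (B \<sigma>) + cobd (\<lambda>\<rho>. evaluate c (cone_homotopy A B f \<rho>)) \<sigma>"
  using \<open>\<sigma> \<in> K\<close>
proof (induction "length \<sigma>" arbitrary: \<sigma> c rule: less_induct)
  case less
  show ?case
  proof (cases "\<sigma> = []")
    case True
    then show ?thesis by (simp add: AB)
  next
    case False
    define c' where "c' = (\<lambda>\<rho>. c (f (hd \<sigma>) # \<rho>))"
    let ?H = "cone_homotopy A B f"
    have *: "(\<lambda>\<rho>. cobd c (f (hd \<sigma>) # \<rho>)) = (\<lambda>\<rho>. c \<rho> + cobd c' \<rho>)"
      by (simp add: cobd_Cons c'_def)
    have "cobd (\<lambda>\<rho>. evaluate (cobd c') (?H \<rho>)) \<sigma> =
      cobd (\<lambda>\<rho>. evaluate c' (A \<rho>) + evaluate c' (B \<rho>) + cobd (\<lambda>\<rho>. evaluate c' (?H \<rho>)) \<rho>) \<sigma>"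
      by (rule cobd_cong[OF K less.prems], rule less.hyps) auto
    also have "\<dots> = evaluate (cobd c') (A \<sigma>) + evaluate (cobd c') (B \<sigma>)"
      using A B less.prems by (simp add: cobd_add cochain_map_on_def)
    finally show ?thesis
      using False by (simp add: evaluate_cone_homotopy Let_def * evaluate_add cobd_add ac_simps)
  qed
qed

text \<open>The homotopy stays in the carrier \<open>F\<close>, since only vertices of the carrier are ever used.\<close>

lemma cone_homotopy_carrier:
  assumes K: "ordered_complex K" and "\<sigma> \<in> K" and "\<rho> \<in> set (cone_homotopy A B f \<sigma>)"
    and AB: "\<And>\<sigma> \<rho>. \<sigma> \<in> K \<Longrightarrow> \<rho> \<in> set (A \<sigma>) \<union> set (B \<sigma>) \<Longrightarrow>
      length \<rho> = length \<sigma> \<and> set \<rho> \<subseteq> F (set \<sigma>)"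
    and "mono F" and f: "\<And>\<sigma> v. v \<in> set \<sigma> \<Longrightarrow> f v \<in> F (set \<sigma>)"
  shows "length \<rho> = Suc (length \<sigma>) \<and> set \<rho> \<subseteq> F (set \<sigma>)"
  using assms(2,3)
proof (induction "length \<sigma>" arbitrary: \<sigma> \<rho> rule: less_induct)
  case less
  then have ne: "\<sigma> \<noteq> []" by auto
  then obtain \<rho>' where \<rho>': "\<rho> = f (hd \<sigma>) # \<rho>'"
    "\<rho>' \<in> set (A \<sigma>) \<union> set (B \<sigma>) \<or> (\<exists>\<pi>\<in>set (faces \<sigma>). \<rho>' \<in> set (cone_homotopy A B f \<pi>))"
    using less.prems by (subst (asm) cone_homotopy.simps) auto
  have "length \<rho>' = length \<sigma> \<and> set \<rho>' \<subseteq> F (set \<sigma>)"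
    using \<rho>'(2)
  proof
    assume "\<exists>\<pi>\<in>set (faces \<sigma>). \<rho>' \<in> set (cone_homotopy A B f \<pi>)"
    then obtain \<pi> where \<pi>: "\<pi> \<in> set (faces \<sigma>)" "\<rho>' \<in> set (cone_homotopy A B f \<pi>)" by blast
    then have "length \<rho>' = Suc (length \<pi>) \<and> set \<rho>' \<subseteq> F (set \<pi>)"
      using ordered_complexD[OF K less.prems(1) set_faces]
      by (intro less.hyps) (auto dest: length_faces)
    with \<pi> show ?thesis
      using monoD[OF \<open>mono F\<close> set_faces[OF \<pi>(1)]] by (auto dest: length_faces)
  qed (use AB less.prems in blast)
  with \<rho>' f[of "hd \<sigma>" \<sigma>] ne show ?case by auto
qed

lemma cone_homotopy_map:
  assumes "\<And>\<sigma>. \<sigma> \<in> K \<Longrightarrow> A (map g \<sigma>) = map (map h) (A \<sigma>)"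
    and "\<And>\<sigma>. \<sigma> \<in> K \<Longrightarrow> B (map g \<sigma>) = map (map h) (B \<sigma>)"
    and "\<And>v. f (g v) = h (f v)"
    and K: "ordered_complex K" and "\<sigma> \<in> K"
  shows "cone_homotopy A B f (map g \<sigma>) = map (map h) (cone_homotopy A B f \<sigma>)"
  using \<open>\<sigma> \<in> K\<close>
proof (induction "length \<sigma>" arbitrary: \<sigma> rule: less_induct)
  case less
  show ?case
  proof (cases "\<sigma> = []")
    case False
    have "cone_homotopy A B f (map g \<rho>) = map (map h) (cone_homotopy A B f \<rho>)"
      if "\<rho> \<in> set (faces \<sigma>)" for \<rho>
      using that less.prems ordered_complexD[OF K less.prems set_faces] 
      by (intro less.hyps) (auto dest: length_faces)
    then have "map (cone_homotopy A B f) (faces (map g \<sigma>)) =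
        map (map (map h)) (map (cone_homotopy A B f) (faces \<sigma>))"
      by (simp add: faces_map)
    then have *: "concat (map (cone_homotopy A B f) (faces (map g \<sigma>))) =
        map (map h) (concat (map (cone_homotopy A B f) (faces \<sigma>)))"
      by (simp only: map_concat)
    show ?thesis
      using False less.prems
      by (subst (1 2) cone_homotopy.simps)
        (simp add: * assms(1-3) hd_map del: map_concat map_map, simp add: map_concat o_def)
  qed simp
qed

section \<open>Contiguous vertex maps\<close>

text \<open>Two vertex maps such that the images of a simplex under both lie in a common simplex induce the same
  map in cohomology. It shows that a refinement map may be replaced by an equivariant one.\<close>

lemma contiguous_maps_cohomologous:
  assumes K: "ordered_complex K" and L: "ordered_complex L"
    and pr: "\<And>\<sigma> \<rho>. \<sigma> \<in> K \<Longrightarrow> set \<rho> \<subseteq> p ` set \<sigma> \<union> r ` set \<sigma> \<Longrightarrow> \<rho> \<in> L"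
    and c: "\<And>\<sigma>. \<sigma> \<in> L \<Longrightarrow> length \<sigma> = Suc n \<Longrightarrow> cobd c \<sigma> = 0"
  obtains b where "\<And>\<sigma>. \<sigma> \<in> K \<Longrightarrow> length \<sigma> = n \<Longrightarrow> c (map p \<sigma>) + c (map r \<sigma>) = cobd b \<sigma>"
proof
  define A where "A = (\<lambda>\<sigma>. [map p \<sigma>])"
  define B where "B = (\<lambda>\<sigma>. [map r \<sigma>])"
  define H where "H = cone_homotopy A B p"
  fix \<sigma> assume \<sigma>: "\<sigma> \<in> K" "length \<sigma> = n"
  have "cochain_map_on K A" "cochain_map_on K B"
    by (auto simp: cochain_map_on_def A_def B_def cobd_map)
  then have "evaluate (cobd c) (H \<sigma>) =
    evaluate c (A \<sigma>) + evaluate c (B \<sigma>) + cobd (\<lambda>\<rho>. evaluate c (H \<rho>)) \<sigma>"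
    unfolding H_def by (rule cone_homotopy[OF K]) (auto simp: A_def B_def \<sigma>)
  moreover have "evaluate (cobd c) (H \<sigma>) = evaluate (\<lambda>_. 0) (H \<sigma>)"
  proof (rule evaluate_cong)
    fix \<rho> assume "\<rho> \<in> set (H \<sigma>)"
    then have "length \<rho> = Suc (length \<sigma>) \<and> set \<rho> \<subseteq> (\<lambda>S. p ` S \<union> r ` S) (set \<sigma>)"
      unfolding H_def
      by (rule cone_homotopy_carrier[OF K \<sigma>(1)]) (auto simp: A_def B_def mono_def)
    then show "cobd c \<rho> = 0"
      using c pr \<sigma> by auto
  qed
  ultimately show "c (map p \<sigma>) + c (map r \<sigma>) = cobd (\<lambda>\<rho>. evaluate c (H \<rho>)) \<sigma>"
    by (simp add: A_def B_def bit_add_eq_0_iff)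
qed

section \<open>Vanishing above the dimension\<close>

text \<open>The standard ordered simplex on a set of vertices.\<close>

definition sorted_enum :: "('v \<Rightarrow> 'v \<Rightarrow> bool) \<Rightarrow> 'v set \<Rightarrow> 'v list" where
  "sorted_enum lt S = (THE xs. sorted_wrt lt xs \<and> set xs = S)"

lemma sorted_wrt_unique:
  assumes "asymp lt"
  shows "sorted_wrt lt xs \<Longrightarrow> sorted_wrt lt ys \<Longrightarrow> set xs = set ys \<Longrightarrow> xs = ys"
proof (induction xs arbitrary: ys)
  case (Cons x xs)
  then obtain y ys' where ys: "ys = y # ys'" by (cases ys) auto
  have xy: "x = y"
  proof (rule ccontr)
    assume "x \<noteq> y"
    then have "y \<in> set xs" "x \<in> set ys'" using Cons.prems ys by auto
    then have "lt x y" "lt y x" using Cons.prems ys by auto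
    then show False using \<open>asymp lt\<close> by (auto dest: asympD)
  qed
  have "x \<notin> set xs" "y \<notin> set ys'"
    using Cons.prems ys \<open>asymp lt\<close> by (auto dest: asympD)
  then have "set xs = set ys'" using Cons.prems ys xy by auto
  then show ?case using Cons.IH[of ys'] Cons.prems ys xy by auto
qed auto

lemma sorted_wrt_exists:
  assumes "transp lt" "finite S" "totalp_on S lt"
  shows "\<exists>xs. sorted_wrt lt xs \<and> set xs = S"
  using assms(2,3)
proof (induction S)
  case (insert x S)
  then obtain xs where xs: "sorted_wrt lt xs" "set xs = S"
    by (meson totalp_on_subset subset_insertI)
  let ?ys = "filter (\<lambda>y. lt y x) xs @ x # filter (\<lambda>y. \<not> lt y x) xs"
  have "lt x y" if "y \<in> S" "\<not> lt y x" for y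
    using that insert.prems insert.hyps by (auto simp: totalp_on_def)
  then have "sorted_wrt lt ?ys"
    using xs \<open>transp lt\<close> by (auto simp: sorted_wrt_append sorted_wrt_filter dest: transpD)
  moreover have "set ?ys = insert x S" using xs by auto
  ultimately show ?case by blast
qed (auto intro: exI[of _ "[]"])

locale strict_order =
  fixes lt :: "'v \<Rightarrow> 'v \<Rightarrow> bool"
  assumes asym: "asymp lt" and trans: "transp lt"
begin

lemma sorted_enum_eq:
  "sorted_wrt lt xs \<Longrightarrow> set xs = S \<Longrightarrow> sorted_enum lt S = xs"
  unfolding sorted_enum_def using sorted_wrt_unique[OF asym] by (intro the_equality) auto

lemma sorted_enum:
  assumes "finite S" "totalp_on S lt"
  shows "sorted_wrt lt (sorted_enum lt S)" "set (sorted_enum lt S) = S"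
  using sorted_wrt_exists[OF trans assms] sorted_enum_eq by metis+

lemma distinct_sorted: "sorted_wrt lt xs \<Longrightarrow> distinct xs"
  using asym by (induction xs) (auto dest: asympD)

end

lemma cobd_distinct:
  "distinct \<sigma> \<Longrightarrow> cobd c \<sigma> = (\<Sum>x\<in>set \<sigma>. c (filter (\<lambda>y. y \<noteq> x) \<sigma>))"
proof (induction \<sigma> arbitrary: c)
  case (Cons v \<sigma>)
  have "filter (\<lambda>y. y \<noteq> v) \<sigma> = \<sigma>" using Cons.prems by (auto simp: filter_id_conv)
  moreover have "(\<Sum>x\<in>set \<sigma>. c (v # filter (\<lambda>y. y \<noteq> x) \<sigma>)) =
      (\<Sum>x\<in>set \<sigma>. c (filter (\<lambda>y. y \<noteq> x) (v # \<sigma>)))"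
    using Cons.prems by (intro sum.cong) auto
  ultimately show ?case
    using Cons by (simp add: cobd_Cons)
qed auto

lemma cobd_distinct_set:
  assumes "distinct \<sigma>"
  shows "cobd (\<lambda>\<rho>. if distinct \<rho> then g (set \<rho>) else 0) \<sigma> = (\<Sum>x\<in>set \<sigma>. g (set \<sigma> - {x}))"
proof -
  have "(\<Sum>x\<in>set \<sigma>. if distinct (filter (\<lambda>y. y \<noteq> x) \<sigma>) then g (set (filter (\<lambda>y. y \<noteq> x) \<sigma>)) else 0)
    = (\<Sum>x\<in>set \<sigma>. g (set \<sigma> - {x}))"
  proof (intro sum.cong refl)
    fix x
    have "set (filter (\<lambda>y. y \<noteq> x) \<sigma>) = set \<sigma> - {x}" by auto
    then show "(if distinct (filter (\<lambda>y. y \<noteq> x) \<sigma>) then g (set (filter (\<lambda>y. y \<noteq> x) \<sigma>)) else 0) =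
      g (set \<sigma> - {x})"
      using assms by (simp add: distinct_filter)
  qed
  then show ?thesis
    using assms by (simp add: cobd_distinct)
qed

lemma cobd_eq_0_if: "(\<And>\<rho>. \<rho> \<in> set (faces \<sigma>) \<Longrightarrow> c \<rho> = 0) \<Longrightarrow> cobd c \<sigma> = 0"
  unfolding cobd_def using evaluate_cong[of "faces \<sigma>" c "\<lambda>_. 0"] by simp

lemma repeated_in_faces:
  "\<rho> \<in> set (faces \<sigma>) \<Longrightarrow> distinct \<rho> \<Longrightarrow> v \<in> set \<sigma> \<Longrightarrow> v \<notin> set \<rho> \<Longrightarrow> distinct \<sigma>"
proof -
  assume *: "\<rho> \<in> set (faces \<sigma>)" "distinct \<rho>" "v \<in> set \<sigma>" "v \<notin> set \<rho>"
  have "\<exists>x. mset \<sigma> = add_mset x (mset \<rho>)"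
    using *(1)
  proof (induction \<sigma> arbitrary: \<rho>)
    case (Cons a \<sigma>)
    show ?case
    proof (cases "\<rho> = \<sigma>")
      case False
      then obtain \<pi> where "\<pi> \<in> set (faces \<sigma>)" "\<rho> = a # \<pi>"
        using Cons.prems by auto
      then obtain x where "mset \<sigma> = add_mset x (mset \<pi>)" using Cons.IH by blast
      then have "mset (a # \<sigma>) = add_mset x (mset \<rho>)"
        using \<open>\<rho> = a # \<pi>\<close> by simp
      then show ?thesis ..
    qed auto
  qed auto
  then obtain x where x: "mset \<sigma> = mset (x # \<rho>)" by auto
  then have "set \<sigma> = set (x # \<rho>)" by (metis set_mset_mset)
  with * have "distinct (x # \<rho>)" by auto
  with x show ?thesis by (metis mset_eq_imp_distinct_iff)
qed

text \<open>If a vertex occurs twice, the only faces without repetition are the ones that omit one of the two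
  occurrences. They have the same vertices and cancel modulo two.\<close>

lemma cobd_degenerate:
  "\<not> distinct \<sigma> \<Longrightarrow> cobd (\<lambda>\<rho>. if distinct \<rho> then g (set \<rho>) else 0) \<sigma> = 0"
proof (induction \<sigma> arbitrary: g)
  case (Cons v \<sigma>)
  let ?c = "\<lambda>\<rho>. if distinct (v # \<rho>) then g (set (v # \<rho>)) else 0"
  consider "v \<notin> set \<sigma>" "\<not> distinct \<sigma>" | "v \<in> set \<sigma>" "distinct \<sigma>" | "v \<in> set \<sigma>" "\<not> distinct \<sigma>"
    using Cons.prems by auto
  then show ?case
  proof cases
    case 1
    have "cobd ?c \<sigma> = cobd (\<lambda>\<rho>. if distinct \<rho> then g (insert v (set \<rho>)) else 0) \<sigma>"
      unfolding cobd_def using 1 by (intro evaluate_cong) (auto dest: set_faces)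
    also have "\<dots> = 0" using Cons.IH[of "\<lambda>S. g (insert v S)"] 1 by simp
    finally show ?thesis using 1 by (simp add: cobd_Cons)
  next
    case 2
    have "cobd ?c \<sigma> = (\<Sum>x\<in>set \<sigma>. ?c (filter (\<lambda>y. y \<noteq> x) \<sigma>))"
      using 2 by (intro cobd_distinct)
    also have "\<dots> = (\<Sum>x\<in>set \<sigma>. if x = v then g (set \<sigma>) else 0)"
    proof (intro sum.cong refl)
      fix x
      show "?c (filter (\<lambda>y. y \<noteq> x) \<sigma>) = (if x = v then g (set \<sigma>) else 0)"
      proof (cases "x = v")
        case True
        have "insert v (set (filter (\<lambda>y. y \<noteq> v) \<sigma>)) = set \<sigma>" using 2 by auto
        with True 2 show ?thesis by (simp add: distinct_filter)
      qed (use 2 in auto)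
    qed
    also have "\<dots> = g (set \<sigma>)" using 2 by simp
    finally show ?thesis using 2 by (simp add: cobd_Cons)
  next
    case 3
    have "cobd ?c \<sigma> = 0"
      using 3 repeated_in_faces by (intro cobd_eq_0_if) fastforce
    then show ?thesis using 3 by (simp add: cobd_Cons)
  qed
qed auto

text \<open>Replacing a simplex by its increasing enumeration, and a simplex with repeated vertices by zero, is a
  chain map \<open>B\<close>, and it is homotopic to the identity \<open>A\<close>, because both are carried by the full simplex
  on the given vertices. Where no simplex of length \<open>n\<close> has distinct vertices, \<open>B\<close> vanishes, and the
  homotopy exhibits the cocycle as a coboundary.
  
  The ordering is pulled back along \<open>\<kappa>\<close> from a well-ordering of its target. Taking for \<open>\<kappa>\<close> the map to
  orbits under \<open>g\<close> makes everything equivariant; it is injective on simplices if these contain at most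
  one vertex of each orbit.\<close>

lemma cocycle_above_dimension:
  fixes \<kappa> :: "'v \<Rightarrow> 'k"
  assumes K: "ordered_complex K" and inj: "\<And>\<sigma>. \<sigma> \<in> K \<Longrightarrow> inj_on \<kappa> (set \<sigma>)"
    and dim: "\<And>\<sigma>. \<sigma> \<in> K \<Longrightarrow> length \<sigma> = n \<Longrightarrow> \<not> distinct \<sigma>"
    and c: "\<And>\<sigma>. \<sigma> \<in> K \<Longrightarrow> length \<sigma> = Suc n \<Longrightarrow> cobd c \<sigma> = 0"
    and g: "\<And>v. \<kappa> (g v) = \<kappa> v"
    and inv: "\<And>\<sigma>. \<sigma> \<in> K \<Longrightarrow> length \<sigma> = n \<Longrightarrow> c (map g \<sigma>) = c \<sigma>"
  obtains b where "\<And>\<sigma>. \<sigma> \<in> K \<Longrightarrow> length \<sigma> = n \<Longrightarrow> c \<sigma> = cobd b \<sigma>"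
    and "\<And>\<sigma>. \<sigma> \<in> K \<Longrightarrow> Suc (length \<sigma>) = n \<Longrightarrow> b (map g \<sigma>) = b \<sigma>"
proof -
  obtain r :: "'k rel" where r: "well_order_on UNIV r" using well_order_on by blast
  define lt where "lt = (\<lambda>v w. (\<kappa> v, \<kappa> w) \<in> r \<and> \<kappa> v \<noteq> \<kappa> w)"
  have lin: "antisym r" "trans r" "total r"
    using r by (auto simp: well_order_on_def linear_order_on_def partial_order_on_def preorder_on_def)
  interpret strict_order lt
  proof
    show "asymp lt"
      using lin by (auto simp: lt_def asymp_on_def antisym_def)
    show "transp lt"
      using lin by (auto simp: lt_def transp_def antisym_def dest: transD)
  qed
  have tot: "totalp_on (set \<sigma>) lt" if "\<sigma> \<in> K" for \<sigma>
    using lin inj[OF that] by (auto simp: lt_def totalp_on_def total_on_def inj_on_def)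
  define A where "A = (\<lambda>\<sigma>::'v list. [\<sigma>])"
  define B where "B = (\<lambda>\<sigma>. if distinct \<sigma> then [sorted_enum lt (set \<sigma>)] else [])"
  have enum: "set (sorted_enum lt (set \<sigma>)) = set \<sigma>"
    "distinct (sorted_enum lt (set \<sigma>))" "sorted_wrt lt (sorted_enum lt (set \<sigma>))" if "\<sigma> \<in> K" for \<sigma>
    using sorted_enum[OF _ tot[OF that]] distinct_sorted by auto
  have A: "cochain_map_on K A" by (simp add: cochain_map_on_def A_def)
  have B: "cochain_map_on K B"
    unfolding cochain_map_on_def
  proof (intro ballI allI)
    fix \<sigma> :: "'v list" and c :: "'v list \<Rightarrow> bit" assume \<sigma>: "\<sigma> \<in> K"
    define g where "g = (\<lambda>S. c (sorted_enum lt S))"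
    have Bg: "(\<lambda>\<rho>. evaluate c (B \<rho>)) = (\<lambda>\<rho>. if distinct \<rho> then g (set \<rho>) else 0)"
      by (auto simp: B_def g_def)
    show "evaluate (cobd c) (B \<sigma>) = cobd (\<lambda>\<rho>. evaluate c (B \<rho>)) \<sigma>"
    proof (cases "distinct \<sigma>")
      case True
      let ?xs = "sorted_enum lt (set \<sigma>)"
      have "evaluate (cobd c) (B \<sigma>) = cobd c ?xs" using True by (simp add: B_def)
      also have "\<dots> = (\<Sum>x\<in>set ?xs. c (filter (\<lambda>y. y \<noteq> x) ?xs))"
        by (rule cobd_distinct) (rule enum[OF \<sigma>])
      also have "\<dots> = (\<Sum>x\<in>set \<sigma>. g (set \<sigma> - {x}))"
      proof (intro sum.cong)
        fix x
        have "sorted_enum lt (set \<sigma> - {x}) = filter (\<lambda>y. y \<noteq> x) ?xs"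
          using enum[OF \<sigma>] by (intro sorted_enum_eq) (auto simp: sorted_wrt_filter)
        then show "c (filter (\<lambda>y. y \<noteq> x) ?xs) = g (set \<sigma> - {x})" by (simp add: g_def)
      qed (use enum[OF \<sigma>] in auto)
      also have "\<dots> = cobd (\<lambda>\<rho>. evaluate c (B \<rho>)) \<sigma>"
        using True by (simp add: Bg cobd_distinct_set)
      finally show ?thesis .
    next
      case False
      then show ?thesis using cobd_degenerate[OF False, of g] by (simp add: Bg) (simp add: B_def)
    qed
  qed
  define H where "H = cone_homotopy A B id"
  have H: "evaluate (cobd c) (H \<sigma>) =
    evaluate c (A \<sigma>) + evaluate c (B \<sigma>) + cobd (\<lambda>\<rho>. evaluate c (H \<rho>)) \<sigma>" if "\<sigma> \<in> K" for \<sigma>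
    unfolding H_def
  proof (rule cone_homotopy[OF K A B _ that])
    show "evaluate c (A []) = evaluate c (B [])" for c
      using sorted_enum_eq[of "[]" "{}"] by (simp add: A_def B_def)
  qed
  have car: "\<rho> \<in> K \<and> length \<rho> = Suc (length \<sigma>)" if "\<sigma> \<in> K" "\<rho> \<in> set (H \<sigma>)" for \<sigma> \<rho>
  proof -
    have "length \<rho> = Suc (length \<sigma>) \<and> set \<rho> \<subseteq> id (set \<sigma>)"
    proof (rule cone_homotopy_carrier[OF K, where A = A and B = B and f = id])
      show "\<rho> \<in> set (cone_homotopy A B id \<sigma>)" using that by (simp add: H_def)
      show "length \<rho> = length \<sigma> \<and> set \<rho> \<subseteq> id (set \<sigma>)"
        if "\<sigma> \<in> K" "\<rho> \<in> set (A \<sigma>) \<union> set (B \<sigma>)" for \<sigma> \<rho>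
        using that enum[OF that(1)] distinct_card[of \<sigma>] distinct_card[of "sorted_enum lt (set \<sigma>)"]
        by (auto simp: A_def B_def split: if_splits)
    qed (use that in \<open>auto simp: mono_def\<close>)
    then show ?thesis using ordered_complexD[OF K that(1)] by simp
  qed
  show ?thesis
  proof
    fix \<sigma> assume \<sigma>: "\<sigma> \<in> K" "length \<sigma> = n"
    have "evaluate (cobd c) (H \<sigma>) = evaluate (\<lambda>_. 0) (H \<sigma>)"
      by (rule evaluate_cong) (use \<sigma> c car in auto)
    moreover have "B \<sigma> = []" using dim \<sigma> by (simp add: B_def)
    ultimately show "c \<sigma> = cobd (\<lambda>\<rho>. evaluate c (H \<rho>)) \<sigma>"
      using H[OF \<sigma>(1)] by (simp add: A_def bit_add_eq_0_iff)
  next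
    fix \<sigma> assume \<sigma>: "\<sigma> \<in> K" "Suc (length \<sigma>) = n"
    have "H (map g \<sigma>) = map (map g) (H \<sigma>)"
      unfolding H_def
    proof (rule cone_homotopy_map[OF _ _ _ K \<sigma>(1)])
      fix \<sigma> assume \<sigma>: "\<sigma> \<in> K"
      have "sorted_enum lt (g ` set \<sigma>) = map g (sorted_enum lt (set \<sigma>))"
        using enum[OF \<sigma>]
        by (intro sorted_enum_eq) (auto simp: sorted_wrt_map lt_def g)
      moreover have "inj_on g (set \<sigma>)"
        using inj[OF \<sigma>] g by (metis inj_on_def)
      ultimately show "B (map g \<sigma>) = map (map g) (B \<sigma>)"
        by (simp add: B_def distinct_map)
    qed (auto simp: A_def)
    then have "evaluate c (H (map g \<sigma>)) = evaluate (\<lambda>\<rho>. c (map g \<rho>)) (H \<sigma>)"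
      by (simp add: evaluate_map)
    also have "\<dots> = evaluate c (H \<sigma>)"
      by (rule evaluate_cong) (use car inv \<sigma> in auto)
    finally show "evaluate c (H (map g \<sigma>)) = evaluate c (H \<sigma>)" .
  qed
qed

section \<open>Free involutions and the powers of their characteristic class\<close>

text \<open>The ordered simplices of the nerve in all dimensions together, including the empty one.\<close>

definition nerve :: "'a set set \<Rightarrow> 'a set list set" where
  "nerve \<W> = {\<sigma>. set \<sigma> \<subseteq> \<W> \<and> \<Inter>(set \<sigma>) \<noteq> {}}"

lemma ordered_complex_nerve: "ordered_complex (nerve \<W>)"
  unfolding ordered_complex_def nerve_def by blast

lemma nerve_refinement_map:
  assumes "refinement_map \<V> \<W> p" "refinement_map \<V> \<W> r"
    and "\<sigma> \<in> nerve \<V>" "set \<rho> \<subseteq> p ` set \<sigma> \<union> r ` set \<sigma>"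
  shows "\<rho> \<in> nerve \<W>"
proof -
  have \<sigma>: "set \<sigma> \<subseteq> \<V>" using assms by (simp add: nerve_def)
  have *: "V \<subseteq> p V" "V \<subseteq> r V" "p V \<in> \<W>" "r V \<in> \<W>" if "V \<in> set \<sigma>" for V
    using assms(1,2) \<sigma> that by (auto simp: refinement_map_def)
  obtain x where x: "x \<in> \<Inter>(set \<sigma>)" using assms(3) by (auto simp: nerve_def)
  have "W \<in> \<W> \<and> x \<in> W" if "W \<in> set \<rho>" for W
    using assms(4) that x * by (blast dest: subsetD)
  then show ?thesis unfolding nerve_def by auto
qed

lemma nerve_map:
  "refinement_map \<V> \<W> p \<Longrightarrow> \<sigma> \<in> nerve \<V> \<Longrightarrow> map p \<sigma> \<in> nerve \<W>"
  using nerve_refinement_map[of \<V> \<W> p p \<sigma> "map p \<sigma>"] by simp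

text \<open>The map is an involution on all points, also outside of the space, so that the induced map on sets is
  an involution on all sets of points; the identity is a suitable choice outside.\<close>

locale free_involution =
  fixes X :: "'a topology" and t :: "'a \<Rightarrow> 'a"
  assumes invol [simp]: "t (t x) = x"
    and cont: "continuous_map X X t"
    and free: "x \<in> topspace X \<Longrightarrow> t x \<noteq> x"
    and Hausdorff: "Hausdorff_space X"
begin

lemma image_invol [simp]: "t ` t ` S = S"
  by (simp add: image_image)

lemma map_image_invol [simp]: "map ((`) t) (map ((`) t) \<sigma>) = \<sigma>"
  by (simp add: o_def)

lemma openin_image: "openin X U \<Longrightarrow> openin X (t ` U)"
proof -
  assume U: "openin X U"
  have "t ` U = {x \<in> topspace X. t x \<in> U}"
    using continuous_map_image_subset_topspace[OF cont] openin_subset[OF U]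
    by (auto simp: image_iff) (metis invol)
  then show ?thesis using openin_continuous_map_preimage[OF cont U] by simp
qed

text \<open>The covers whose nerve carries a free action of the involution; no simplex contains a set together
  with its image, as these are disjoint.\<close>

definition free_cover :: "'a set set \<Rightarrow> bool" where
  "free_cover \<W> \<longleftrightarrow> open_cover X \<W> \<and> {} \<notin> \<W> \<and> (\<forall>W\<in>\<W>. t ` W \<in> \<W> \<and> W \<inter> t ` W = {})"

lemma free_coverD:
  assumes "free_cover \<W>"
  shows "open_cover X \<W>" "{} \<notin> \<W>" "W \<in> \<W> \<Longrightarrow> t ` W \<in> \<W>" "W \<in> \<W> \<Longrightarrow> W \<inter> t ` W = {}"
    "W \<in> \<W> \<Longrightarrow> t ` W \<noteq> W"
proof -
  show "open_cover X \<W>" "{} \<notin> \<W>" using assms by (auto simp: free_cover_def)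
  show "t ` W \<in> \<W>" "W \<inter> t ` W = {}" if "W \<in> \<W>"
    using assms that by (auto simp: free_cover_def)
  then show "t ` W \<noteq> W" if "W \<in> \<W>"
    using that \<open>{} \<notin> \<W>\<close> by (metis inf.idem)
qed

lemma nerve_image:
  assumes "free_cover \<W>" "\<sigma> \<in> nerve \<W>"
  shows "map ((`) t) \<sigma> \<in> nerve \<W>"
proof -
  obtain x where "x \<in> \<Inter>(set \<sigma>)" using assms by (auto simp: nerve_def)
  then have "t x \<in> \<Inter>(set (map ((`) t) \<sigma>))" by auto
  then have "\<Inter>(set (map ((`) t) \<sigma>)) \<noteq> {}" by blast
  moreover have "set (map ((`) t) \<sigma>) \<subseteq> \<W>"
    using assms by (auto simp: nerve_def free_cover_def)
  ultimately show ?thesis by (simp add: nerve_def)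
qed

lemma free_nbhd:
  assumes "x \<in> topspace X"
  obtains U where "openin X U" "x \<in> U" "U \<inter> t ` U = {}"
proof -
  have tx: "t x \<in> topspace X" "x \<noteq> t x"
    using cont assms free[OF assms] by (auto simp: continuous_map_def)
  then obtain A B where AB: "openin X A" "openin X B" "x \<in> A" "t x \<in> B" "A \<inter> B = {}"
    using Hausdorff assms unfolding Hausdorff_space_def disjnt_def by metis
  have "A \<inter> t ` B \<inter> t ` (A \<inter> t ` B) = {}" 
    using AB by (auto simp: image_iff)
  moreover have "x \<in> A \<inter> t ` B" using AB by (auto simp: image_iff intro: bexI[of _ "t x"])
  moreover have "openin X (A \<inter> t ` B)" using AB openin_image by (simp add: openin_Int)
  ultimately show ?thesis by (intro that)
qed

text \<open>Free covers are cofinal: all open sets that are disjoint from their image and small together with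
  their image form a cover that is invariant by construction.\<close>

lemma free_refinement:
  assumes "open_cover X \<U>"
  obtains \<W> q where "free_cover \<W>" "refinement_map \<W> \<U> q"
proof -
  define \<W> where "\<W> = {W. openin X W \<and> W \<noteq> {} \<and> W \<inter> t ` W = {} \<and> (\<exists>U\<in>\<U>. W \<subseteq> U) \<and> (\<exists>U\<in>\<U>. t ` W \<subseteq> U)}"
  have "\<exists>W\<in>\<W>. x \<in> W" if x: "x \<in> topspace X" for x
  proof -
    have tx: "t x \<in> topspace X" using cont x by (auto simp: continuous_map_def)
    obtain U V where UV: "U \<in> \<U>" "V \<in> \<U>" "x \<in> U" "t x \<in> V" "openin X U" "openin X V"
      using assms x tx unfolding open_cover_def by blast
    obtain F where F: "openin X F" "x \<in> F" "F \<inter> t ` F = {}" using free_nbhd x by blast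
    define W where "W = U \<inter> F \<inter> t ` V"
    have "t ` W \<subseteq> V" unfolding W_def by auto
    moreover have "x \<in> W" using UV F by (auto simp: W_def image_iff intro: bexI[of _ "t x"])
    moreover have "openin X W" 
      using UV F openin_image unfolding W_def by (simp add: openin_Int)
    moreover have "W \<inter> t ` W = {}" using F by (auto simp: W_def)
    moreover have "W \<subseteq> U" by (simp add: W_def Int_assoc)
    ultimately have "W \<in> \<W>" using UV(1,2) unfolding \<W>_def by blast
    then show ?thesis using \<open>x \<in> W\<close> by blast
  qed
  moreover have "t ` W \<in> \<W>" if "W \<in> \<W>" for W
    using that openin_image unfolding \<W>_def by (auto simp: Int_commute)
  ultimately have "free_cover \<W>"
    unfolding free_cover_def open_cover_def
    by (auto simp: \<W>_def dest: openin_subset)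
  moreover obtain q where "refinement_map \<W> \<U> q"
  proof -
    have "\<forall>W\<in>\<W>. \<exists>U. U \<in> \<U> \<and> W \<subseteq> U" by (auto simp: \<W>_def)
    then show ?thesis using that unfolding refinement_map_def by metis
  qed
  ultimately show ?thesis using that by blast
qed

text \<open>A choice of one set in every orbit, as an indicator function with values modulo two.\<close>

definition sheet :: "'a set \<Rightarrow> bit" where
  "sheet V = (if V = (SOME U. U \<in> {V, t ` V}) then 1 else 0)"

lemma sheet_image: "t ` V \<noteq> V \<Longrightarrow> sheet (t ` V) = sheet V + 1"
proof -
  assume V: "t ` V \<noteq> V"
  define S where "S = (SOME U. U \<in> {V, t ` V})"
  have "S \<in> {V, t ` V}" unfolding S_def by (rule someI_ex) blast
  moreover have "sheet V = (if V = S then 1 else 0)" "sheet (t ` V) = (if t ` V = S then 1 else 0)"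
    by (simp_all add: sheet_def S_def insert_commute)
  ultimately show ?thesis using V by auto
qed

text \<open>Follow the given refinement map on one sheet and extend it equivariantly to the other.\<close>

lemma equivariant_refinement:
  assumes \<V>: "free_cover \<V>" and \<W>: "free_cover \<W>" and p: "refinement_map \<V> \<W> p"
  obtains r where "refinement_map \<V> \<W> r" "\<And>V. V \<in> \<V> \<Longrightarrow> r (t ` V) = t ` r V"
proof
  let ?r = "\<lambda>V. if sheet V = 1 then p V else t ` p (t ` V)"
  show "refinement_map \<V> \<W> ?r"
    unfolding refinement_map_def
  proof
    fix V assume V: "V \<in> \<V>"
    then have "t ` V \<subseteq> p (t ` V)" "p (t ` V) \<in> \<W>"
      using p free_coverD[OF \<V>] unfolding refinement_map_def by blast+
    then have "V \<subseteq> t ` p (t ` V)" "t ` p (t ` V) \<in> \<W>"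
      using free_coverD[OF \<W>] by (metis image_invol image_mono)+
    then show "?r V \<in> \<W> \<and> V \<subseteq> ?r V"
      using p V unfolding refinement_map_def by auto
  qed
  show "?r (t ` V) = t ` ?r V" if "V \<in> \<V>" for V
    using sheet_image[OF free_coverD(5)[OF \<V> that]] by (cases "sheet V") auto
qed

text \<open>The cochains that represent the \<open>k\<close>-th power of the characteristic class of the free involution: the
  connecting homomorphism of the short exact sequence
  \<open>0 \<rightarrow> invariant cochains \<rightarrow> cochains \<rightarrow> invariant cochains \<rightarrow> 0\<close>, whose second map is \<open>1 + t\<close>, is
  applied \<open>k\<close> times to the unit. Here \<open>s\<close> is a lift of the previous cochain along \<open>1 + t\<close>.\<close>

primrec char_cochain :: "'a set set \<Rightarrow> nat \<Rightarrow> ('a set list \<Rightarrow> bit) \<Rightarrow> bool" where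
  "char_cochain \<W> 0 c \<longleftrightarrow> (\<forall>W. [W] \<in> nerve \<W> \<longrightarrow> c [W] = 1)"
| "char_cochain \<W> (Suc k) c \<longleftrightarrow>
    (\<exists>s. char_cochain \<W> k (\<lambda>\<sigma>. s \<sigma> + s (map ((`) t) \<sigma>)) \<and>
      (\<forall>\<sigma>\<in>nerve \<W>. length \<sigma> = k + 2 \<longrightarrow> c \<sigma> = cobd s \<sigma>))"

lemma char_cochain_cong:
  assumes "\<And>\<sigma>. \<sigma> \<in> nerve \<W> \<Longrightarrow> length \<sigma> = Suc k \<Longrightarrow> c \<sigma> = d \<sigma>"
  shows "char_cochain \<W> k c \<longleftrightarrow> char_cochain \<W> k d"
  using assms by (cases k) auto

lemma char_cochain_cocycle:
  assumes "char_cochain \<W> k c" "\<sigma> \<in> nerve \<W>" "length \<sigma> = k + 2"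
  shows "cobd c \<sigma> = 0"
proof (cases k)
  case 0
  then obtain V W where \<sigma>: "\<sigma> = [V, W]" using assms by (auto simp: length_Suc_conv)
  then have "[V] \<in> nerve \<W>" "[W] \<in> nerve \<W>"
    using assms(2) ordered_complexD[OF ordered_complex_nerve assms(2)] by auto
  then show ?thesis using assms 0 \<sigma> by (simp add: cobd_Cons)
next
  case (Suc j)
  then obtain s where "\<And>\<sigma>. \<sigma> \<in> nerve \<W> \<Longrightarrow> length \<sigma> = j + 2 \<Longrightarrow> c \<sigma> = cobd s \<sigma>"
    using assms(1) by auto
  then have "cobd c \<sigma> = cobd (cobd s) \<sigma>"
    using assms Suc by (intro cobd_cong[OF ordered_complex_nerve]) auto
  then show ?thesis by simp
qed

lemma char_cochain_invariant:
  assumes "free_cover \<W>" "char_cochain \<W> k c" "\<sigma> \<in> nerve \<W>" "length \<sigma> = Suc k"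
  shows "c (map ((`) t) \<sigma>) = c \<sigma>"
proof (cases k)
  case 0
  then obtain W where "\<sigma> = [W]" using assms by (auto simp: length_Suc_conv)
  then show ?thesis using assms 0 nerve_image[of \<W> "[W]"] by simp
next
  case (Suc j)
  then obtain s where s: "char_cochain \<W> j (\<lambda>\<sigma>. s \<sigma> + s (map ((`) t) \<sigma>))"
    "\<And>\<sigma>. \<sigma> \<in> nerve \<W> \<Longrightarrow> length \<sigma> = j + 2 \<Longrightarrow> c \<sigma> = cobd s \<sigma>"
    using assms(2) by auto
  have "c \<sigma> + c (map ((`) t) \<sigma>) = cobd (\<lambda>\<sigma>. s \<sigma> + s (map ((`) t) \<sigma>)) \<sigma>"
    using s(2)[OF assms(3)] s(2)[OF nerve_image[OF assms(1,3)]] assms(4) Suc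
    by (simp add: cobd_add cobd_map)
  also have "\<dots> = 0" using char_cochain_cocycle[OF s(1) assms(3)] assms(4) Suc by simp
  finally show ?thesis by (simp add: bit_add_eq_0_iff)
qed

text \<open>A lift of an invariant cochain along \<open>1 + t\<close> is obtained by restricting it to the simplices
  whose leading vertex lies on the chosen sheet.\<close>

lemma char_cochain_exists:
  assumes "free_cover \<W>"
  shows "\<exists>c. char_cochain \<W> k c"
proof (induction k)
  case 0
  show ?case by (auto intro: exI[of _ "\<lambda>_. 1"])
next
  case (Suc k)
  then obtain c where c: "char_cochain \<W> k c" by blast
  define s where "s = (\<lambda>\<sigma>. sheet (hd \<sigma>) * c \<sigma>)"
  have "char_cochain \<W> k (\<lambda>\<sigma>. s \<sigma> + s (map ((`) t) \<sigma>))"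
  proof (rule iffD1[OF char_cochain_cong c])
    fix \<sigma> assume \<sigma>: "\<sigma> \<in> nerve \<W>" "length \<sigma> = Suc k"
    then have "\<sigma> \<noteq> []" by auto
    then have "hd \<sigma> \<in> \<W>" using \<sigma> hd_in_set by (auto simp: nerve_def)
    then have "sheet (t ` hd \<sigma>) = sheet (hd \<sigma>) + 1"
      by (intro sheet_image free_coverD(5)[OF assms])
    then show "c \<sigma> = s \<sigma> + s (map ((`) t) \<sigma>)"
      using char_cochain_invariant[OF assms c \<sigma>] \<open>\<sigma> \<noteq> []\<close>
      by (simp add: s_def hd_map distrib_right)
  qed
  then show ?case
    unfolding char_cochain.simps by (intro exI[of _ "cobd s"] exI[of _ s] conjI ballI impI refl)
qed

lemma char_cochain_pullback:
  assumes \<V>: "free_cover \<V>" and r: "refinement_map \<V> \<W> r"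
    and eq: "\<And>V. V \<in> \<V> \<Longrightarrow> r (t ` V) = t ` r V"
  shows "char_cochain \<W> k c \<Longrightarrow> char_cochain \<V> k (\<lambda>\<sigma>. c (map r \<sigma>))"
proof (induction k arbitrary: c)
  case 0
  then show ?case using nerve_map[OF r] by fastforce
next
  case (Suc k)
  then obtain s where s: "char_cochain \<W> k (\<lambda>\<sigma>. s \<sigma> + s (map ((`) t) \<sigma>))"
    "\<And>\<sigma>. \<sigma> \<in> nerve \<W> \<Longrightarrow> length \<sigma> = k + 2 \<Longrightarrow> c \<sigma> = cobd s \<sigma>" by auto
  let ?s = "\<lambda>\<sigma>. s (map r \<sigma>)"
  have "map ((`) t) (map r \<sigma>) = map r (map ((`) t) \<sigma>)" if "\<sigma> \<in> nerve \<V>" for \<sigma>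
    using that eq by (auto simp: nerve_def)
  then have "char_cochain \<V> k (\<lambda>\<sigma>. ?s \<sigma> + ?s (map ((`) t) \<sigma>))"
    by (intro iffD1[OF char_cochain_cong Suc.IH[OF s(1)]]) (simp del: map_map)
  moreover have "c (map r \<sigma>) = cobd ?s \<sigma>" if "\<sigma> \<in> nerve \<V>" "length \<sigma> = k + 2" for \<sigma>
    using s(2)[OF nerve_map[OF r that(1)]] that(2) by (simp add: cobd_map)
  ultimately show ?case
    unfolding char_cochain.simps by (intro exI[of _ ?s] conjI ballI impI)
qed

text \<open>The \<open>k\<close>-th power of the characteristic class is zero in the cohomology of the orbit space: on some
  free cover a representative is the coboundary of an invariant cochain of degree \<open>k - 1\<close>, that is, one on
  lists of length \<open>k\<close>.\<close>

definition char_power_vanishes :: "nat \<Rightarrow> bool" where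
  "char_power_vanishes k \<longleftrightarrow> (\<exists>\<W> c b. free_cover \<W> \<and> char_cochain \<W> k c \<and>
    (\<forall>\<sigma>\<in>nerve \<W>. length \<sigma> = k \<longrightarrow> b (map ((`) t) \<sigma>) = b \<sigma>) \<and>
    (\<forall>\<sigma>\<in>nerve \<W>. length \<sigma> = Suc k \<longrightarrow> c \<sigma> = cobd b \<sigma>))"

end

text \<open>The vanishing of Cech cohomology in degree \<open>k\<close>, without forming classes. Cochains are arbitrary
  functions of lists, of which only the values on the nerve matter.\<close>

definition cech_vanishes :: "'a topology \<Rightarrow> nat \<Rightarrow> bool" where
  "cech_vanishes X k \<longleftrightarrow> (\<forall>\<U> c. open_cover X \<U> \<and>
      (\<forall>\<sigma>\<in>nerve \<U>. length \<sigma> = k + 2 \<longrightarrow> cobd c \<sigma> = 0) \<longrightarrow>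
    (\<exists>\<V> p a. open_cover X \<V> \<and> refinement_map \<V> \<U> p \<and>
      (\<forall>\<sigma>\<in>nerve \<V>. length \<sigma> = Suc k \<longrightarrow> c (map p \<sigma>) = cobd a \<sigma>)))"

context free_involution
begin

text \<open>The injectivity of multiplication by the characteristic class. If \<open>cobd s\<close>, which represents the power
  \<open>k + 1\<close>, is the coboundary of an invariant cochain \<open>b\<close>, then \<open>s + b\<close> is a cocycle of degree \<open>k\<close>, in
  general not invariant. On a refinement it is the coboundary of some \<open>a'\<close>, and applying \<open>1 + t\<close>, which
  kills \<open>b\<close>, shows that \<open>(1 + t) s\<close>, which represents the power \<open>k\<close>, is the coboundary of the invariant
  cochain \<open>(1 + t) a'\<close>.\<close>

lemma char_power_vanishes_descend:
  assumes "char_power_vanishes (Suc k)" and van: "cech_vanishes X k"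
  shows "char_power_vanishes k"
proof -
  let ?T = "map ((`) t)"
  from assms(1)[unfolded char_power_vanishes_def]
  obtain \<W> c b where \<W>: "free_cover \<W>" and c: "char_cochain \<W> (Suc k) c"
    and b: "\<forall>\<sigma>\<in>nerve \<W>. length \<sigma> = Suc k \<longrightarrow> b (?T \<sigma>) = b \<sigma>"
    and cb: "\<forall>\<sigma>\<in>nerve \<W>. length \<sigma> = Suc (Suc k) \<longrightarrow> c \<sigma> = cobd b \<sigma>"
    by (elim exE conjE) (rule that)
  obtain s where s: "char_cochain \<W> k (\<lambda>\<sigma>. s \<sigma> + s (?T \<sigma>))"
    and cs: "\<And>\<sigma>. \<sigma> \<in> nerve \<W> \<Longrightarrow> length \<sigma> = k + 2 \<Longrightarrow> c \<sigma> = cobd s \<sigma>"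
    using c by auto
  \<comment> \<open>The difference of two cochains with the same coboundary.\<close>
  define e where "e = (\<lambda>\<sigma>. s \<sigma> + b \<sigma>)"
  have e: "cobd e \<sigma> = 0" if "\<sigma> \<in> nerve \<W>" "length \<sigma> = k + 2" for \<sigma>
    using cb[rule_format, OF that(1)] cs[OF that] that(2) by (simp add: e_def cobd_add)
  obtain \<V> p a where \<V>: "open_cover X \<V>" and p: "refinement_map \<V> \<W> p"
    and a: "\<And>\<sigma>. \<sigma> \<in> nerve \<V> \<Longrightarrow> length \<sigma> = Suc k \<Longrightarrow> e (map p \<sigma>) = cobd a \<sigma>"
    using van[unfolded cech_vanishes_def, rule_format, of \<W> e] free_coverD(1)[OF \<W>] e by metis
  obtain \<V>' q where \<V>': "free_cover \<V>'" and q: "refinement_map \<V>' \<V> q"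
    using free_refinement[OF \<V>] .
  have pq: "refinement_map \<V>' \<W> (p \<circ> q)"
    using p q unfolding refinement_map_def by fastforce
  obtain r where r: "refinement_map \<V>' \<W> r" and req: "\<And>V. V \<in> \<V>' \<Longrightarrow> r (t ` V) = t ` r V"
    using equivariant_refinement[OF \<V>' \<W> pq] by metis
  obtain h where h: "\<And>\<sigma>. \<sigma> \<in> nerve \<V>' \<Longrightarrow> length \<sigma> = Suc k \<Longrightarrow>
      e (map (p \<circ> q) \<sigma>) + e (map r \<sigma>) = cobd h \<sigma>"
  proof (rule contiguous_maps_cohomologous[of "nerve \<V>'" "nerve \<W>" "p \<circ> q" r "Suc k" e])
    show "\<rho> \<in> nerve \<W>" if "\<sigma> \<in> nerve \<V>'" "set \<rho> \<subseteq> (p \<circ> q) ` set \<sigma> \<union> r ` set \<sigma>" for \<sigma> \<rho>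
      using nerve_refinement_map[OF pq r that] .
  qed (use e that ordered_complex_nerve in auto)
  define a' where "a' = (\<lambda>\<sigma>. a (map q \<sigma>) + h \<sigma>)"
  have a': "e (map r \<sigma>) = cobd a' \<sigma>" if "\<sigma> \<in> nerve \<V>'" "length \<sigma> = Suc k" for \<sigma>
  proof -
    have "e (map (p \<circ> q) \<sigma>) = cobd a (map q \<sigma>)"
      using a[OF nerve_map[OF q that(1)]] that(2) by simp
    moreover have "e (map r \<sigma>) = e (map (p \<circ> q) \<sigma>) + cobd h \<sigma>"
      using h[OF that] by (metis bit_add_same_left)
    ultimately show ?thesis by (simp add: a'_def cobd_add cobd_map)
  qed
  define b' where "b' = (\<lambda>\<sigma>. a' \<sigma> + a' (?T \<sigma>))"
  define c' where "c' = (\<lambda>\<sigma>. s (map r \<sigma>) + s (?T (map r \<sigma>)))"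
  have "char_cochain \<V>' k c'"
    using char_cochain_pullback[OF \<V>' r req s] by (simp add: c'_def)
  moreover have "c' \<sigma> = cobd b' \<sigma>" if \<sigma>: "\<sigma> \<in> nerve \<V>'" "length \<sigma> = Suc k" for \<sigma>
  proof -
    have "map r (?T \<sigma>) = ?T (map r \<sigma>)"
      using \<sigma> req by (auto simp: nerve_def)
    moreover have "b (?T (map r \<sigma>)) = b (map r \<sigma>)"
      using b nerve_map[OF r \<sigma>(1)] \<sigma>(2) by (simp del: map_map)
    ultimately have "c' \<sigma> = e (map r \<sigma>) + e (map r (?T \<sigma>))"
      by (simp add: c'_def e_def ac_simps del: map_map)
    also have "\<dots> = cobd a' \<sigma> + cobd a' (?T \<sigma>)"
      using a' \<sigma> nerve_image[OF \<V>'] by (simp del: map_map)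
    finally show ?thesis by (simp add: b'_def cobd_add cobd_map del: map_map)
  qed
  moreover have "b' (?T \<sigma>) = b' \<sigma>" for \<sigma>
    by (simp add: b'_def add.commute del: map_map)
  ultimately show ?thesis
    using \<V>' unfolding char_power_vanishes_def
    by (intro exI[of _ \<V>'] exI[of _ c'] exI[of _ b'] conjI ballI impI) simp_all
qed

text \<open>A finite-dimensional cover by sets disjoint from their images becomes invariant by adding the
  images; at most twice as many of its members meet in a point.\<close>

lemma finite_dimensional_free_cover:
  assumes "finitistic_space X"
  obtains \<W> n where "free_cover \<W>" "\<And>\<sigma>. \<sigma> \<in> nerve \<W> \<Longrightarrow> card (set \<sigma>) \<le> n"
proof -
  let ?\<U> = "{U. openin X U \<and> U \<inter> t ` U = {}}"
  have "x \<in> \<Union>?\<U>" if "x \<in> topspace X" for x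
    using free_nbhd[OF that] by blast
  then have "open_cover X ?\<U>"
    unfolding open_cover_def using openin_subset by blast
  then have "\<exists>\<V>. open_cover X \<V> \<and> refines \<V> ?\<U> \<and> finite_dimensional_cover \<V>"
    using assms by (simp add: finitistic_space_def)
  then obtain \<V> where \<V>: "open_cover X \<V>" "refines \<V> ?\<U>" "finite_dimensional_cover \<V>"
    by (elim exE conjE) (rule that)
  then obtain N where
    N: "\<forall>F. F \<subseteq> \<V> \<and> finite F \<and> F \<noteq> {} \<and> \<Inter>F \<noteq> {} \<longrightarrow> card F \<le> Suc N"
    unfolding finite_dimensional_cover_def by (elim exE) (rule that)
  define \<W> where "\<W> = (\<V> \<union> (`) t ` \<V>) - {{}}"
  have free: "V \<inter> t ` V = {}" if "V \<in> \<V>" for V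
  proof -
    obtain U where U: "U \<inter> t ` U = {}" "V \<subseteq> U" using \<V>(2) \<open>V \<in> \<V>\<close> unfolding refines_def
      by (simp, metis)
    have "V \<inter> t ` V \<subseteq> U \<inter> t ` U" using U(2) by (intro Int_mono image_mono)
    with U(1) show ?thesis by simp
  qed
  have "free_cover \<W>"
    unfolding free_cover_def
  proof (intro conjI ballI)
    have "t ` V \<subseteq> topspace X" if "V \<in> \<V>" for V
      using \<V>(1) that openin_subset[OF openin_image] unfolding open_cover_def by simp
    then show "open_cover X \<W>"
      using \<V>(1) openin_image unfolding open_cover_def \<W>_def by auto
    fix W assume W: "W \<in> \<W>"
    then obtain V where "V \<in> \<V>" "W = V \<or> W = t ` V" by (auto simp: \<W>_def)
    then show "W \<inter> t ` W = {}" using free[of V] by (auto simp: image_image)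
    show "t ` W \<in> \<W>"
      using W \<open>V \<in> \<V>\<close> \<open>W = V \<or> W = t ` V\<close> by (auto simp: \<W>_def)
  qed (simp add: \<W>_def)
  moreover have "card (set \<sigma>) \<le> Suc N + Suc N" if \<sigma>: "\<sigma> \<in> nerve \<W>" for \<sigma>
  proof -
    have bound: "card F \<le> Suc N" if "F \<subseteq> \<V>" "finite F" "x \<in> \<Inter>F" for F x
    proof (cases "F = {}")
      case False
      have "\<Inter>F \<noteq> {}" using that(3) by blast
      then show ?thesis using N that(1,2) False by simp
    qed simp
    obtain x where x: "x \<in> \<Inter>(set \<sigma>)" using \<sigma> by (auto simp: nerve_def)
    \<comment> \<open>A member is either old or the image of an old one; the old ones contain \<open>x\<close>, the images
      of the others contain \<open>t x\<close>.\<close>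
    let ?A = "set \<sigma> \<inter> \<V>" and ?B = "(`) t ` set \<sigma> \<inter> \<V>"
    have "set \<sigma> \<subseteq> ?A \<union> (`) t ` ?B"
    proof
      fix W assume W: "W \<in> set \<sigma>"
      then have "W \<in> \<V> \<or> t ` W \<in> \<V>" using \<sigma> by (auto simp: nerve_def \<W>_def)
      then show "W \<in> ?A \<union> (`) t ` ?B"
      proof
        assume "t ` W \<in> \<V>"
        then have "t ` W \<in> ?B" using W by (intro IntI imageI)
        then have "t ` t ` W \<in> (`) t ` ?B" by (rule imageI)
        then show ?thesis by simp
      qed (use W in simp)
    qed
    then have "card (set \<sigma>) \<le> card (?A \<union> (`) t ` ?B)" by (intro card_mono) auto
    also have "\<dots> \<le> card ?A + card ?B"
      by (meson card_Un_le card_image_le add_left_mono order_trans finite_Int finite_imageI finite_set)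
    also have "card ?A \<le> Suc N" using x by (intro bound[of _ x]) auto
    also have "card ?B \<le> Suc N" using x by (intro bound[of _ "t x"]) auto
    finally show ?thesis by simp
  qed
  ultimately show ?thesis using that by blast
qed

lemma char_power_vanishes_eventually:
  assumes "finitistic_space X"
  shows "\<exists>K. \<forall>k\<ge>K. char_power_vanishes k"
proof -
  let ?T = "map ((`) t)"
  obtain \<W> n where \<W>: "free_cover \<W>" and n: "\<And>\<sigma>. \<sigma> \<in> nerve \<W> \<Longrightarrow> card (set \<sigma>) \<le> n"
    using finite_dimensional_free_cover[OF assms] by blast
  define \<kappa> where "\<kappa> = (\<lambda>W. {W, t ` W})"
  have \<kappa>: "\<kappa> (t ` W) = \<kappa> W" for W by (auto simp: \<kappa>_def)
  have inj: "inj_on \<kappa> (set \<sigma>)" if \<sigma>: "\<sigma> \<in> nerve \<W>" for \<sigma>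
  proof (rule inj_onI)
    fix V W assume VW: "V \<in> set \<sigma>" "W \<in> set \<sigma>" "\<kappa> V = \<kappa> W"
    then have "V \<inter> W \<noteq> {}" "V \<in> \<W>" using \<sigma> unfolding nerve_def by blast+
    then have "W \<noteq> t ` V" using free_coverD(4)[OF \<W>] by blast
    with VW show "V = W" by (auto simp: \<kappa>_def doubleton_eq_iff)
  qed
  have "char_power_vanishes k" if k: "k \<ge> n" for k
  proof -
    obtain c where c: "char_cochain \<W> k c" using char_cochain_exists[OF \<W>] by blast
    obtain b where
      b: "\<And>\<sigma>. \<sigma> \<in> nerve \<W> \<Longrightarrow> length \<sigma> = Suc k \<Longrightarrow> c \<sigma> = cobd b \<sigma>"
      and inv: "\<And>\<sigma>. \<sigma> \<in> nerve \<W> \<Longrightarrow> Suc (length \<sigma>) = Suc k \<Longrightarrow> b (?T \<sigma>) = b \<sigma>"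
    proof (rule cocycle_above_dimension[OF ordered_complex_nerve inj])
      show "\<not> distinct \<sigma>" if "\<sigma> \<in> nerve \<W>" "length \<sigma> = Suc k" for \<sigma>
        using n[OF that(1)] that(2) k distinct_card[of \<sigma>] by auto
      show "cobd c \<sigma> = 0" if "\<sigma> \<in> nerve \<W>" "length \<sigma> = Suc (Suc k)" for \<sigma>
        using char_cochain_cocycle[OF c] that by simp
      show "c (?T \<sigma>) = c \<sigma>" if "\<sigma> \<in> nerve \<W>" "length \<sigma> = Suc k" for \<sigma>
        using char_cochain_invariant[OF \<W> c that] .
    qed (use \<kappa> that in simp_all)
    then show ?thesis
      using \<W> c b inv unfolding char_power_vanishes_def
      by (intro exI[of _ \<W>] exI[of _ c] exI[of _ b] conjI ballI impI) simp_all
  qed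
  then show ?thesis by blast
qed

text \<open>Start in a degree above the dimension of a nerve and descend.\<close>

lemma char_power_vanishes_above:
  assumes "finitistic_space X" and van: "\<And>k. k > N \<Longrightarrow> cech_vanishes X k" and "d > N"
  shows "char_power_vanishes d"
proof -
  obtain K where K: "\<And>k. k \<ge> K \<Longrightarrow> char_power_vanishes k"
    using char_power_vanishes_eventually[OF assms(1)] by blast
  have "d \<le> max d K" "char_power_vanishes (max d K)" using K by auto
  then show ?thesis
  proof (induction rule: inc_induct)
    case (step k)
    then show ?case using char_power_vanishes_descend van \<open>d > N\<close> by simp
  qed auto
qed

end

section \<open>Lebesgue numbers in coordinates\<close>

lemma compact_space_nsphere: "compact_space (nsphere n)"
proof -
  let ?X = "powertop_real UNIV"
  let ?S = "{x :: nat \<Rightarrow> real. (\<Sum>i\<le>n. x i ^ 2) = 1 \<and> (\<forall>i>n. x i = 0)}"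
  have "compactin ?X ?S"
  proof (rule closed_compactin)
    show "compactin ?X (UNIV \<rightarrow>\<^sub>E {-1..1})"
      by (simp add: compactin_PiE)
    show "?S \<subseteq> UNIV \<rightarrow>\<^sub>E {-1..1}"
    proof
      fix x :: "nat \<Rightarrow> real" assume x: "x \<in> ?S"
      have "x i \<in> {-1..1}" for i
      proof (cases "i \<le> n")
        case True
        then have "x i ^ 2 \<le> (\<Sum>i\<le>n. x i ^ 2)" by (intro member_le_sum) auto
        then show ?thesis using x by (simp add: abs_square_le_1 abs_le_iff)
      qed (use x in auto)
      then show "x \<in> UNIV \<rightarrow>\<^sub>E {-1..1}" by auto
    qed
    have eq: "?S = (\<Inter>i \<in> {n<..}. {x \<in> topspace ?X. x i \<in> {0}}) \<inter>
        {x \<in> topspace ?X. (\<Sum>i\<le>n. x i ^ 2) \<in> {1}}"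
      by (auto simp: topspace_product_topology)
    show "closedin ?X ?S"
      unfolding eq
      by (rule closedin_Int closedin_Inter continuous_map_sum continuous_map_real_pow
          continuous_map_product_projection closedin_continuous_map_preimage | force | clarify)+
  qed
  then show ?thesis
    by (simp add: nsphere compact_space_subtopology)
qed

text \<open>Finitely many continuous functions that separate the points of a compact space give it a
  metric \<open>h\<close>, and this is the Lebesgue number lemma for it, with boxes in place of balls.\<close>

lemma Lebesgue_number_coordinates:
  fixes g :: "'i \<Rightarrow> 'a \<Rightarrow> real"
  assumes Y: "compact_space Y" and I: "finite I"
    and g: "\<And>i. i \<in> I \<Longrightarrow> continuous_map Y euclideanreal (g i)"
    and inj: "\<And>x y. x \<in> topspace Y \<Longrightarrow> y \<in> topspace Y \<Longrightarrow> (\<And>i. i \<in> I \<Longrightarrow> g i x = g i y) \<Longrightarrow> x = y"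
    and \<U>: "open_cover Y \<U>"
  obtains e where "e > 0" and "\<And>y. y \<in> topspace Y \<Longrightarrow>
    \<exists>U\<in>\<U>. \<forall>z\<in>topspace Y. (\<forall>i\<in>I. \<bar>g i z - g i y\<bar> < e) \<longrightarrow> z \<in> U"
proof -
  define h where "h = (\<lambda>y z. \<Sum>i\<in>I. \<bar>g i z - g i y\<bar>)"
  have h: "continuous_map Y euclideanreal (h y)" for y
    unfolding h_def using g I by (intro continuous_intros) auto
  have tri: "h y w \<le> h y z + h z w" for y z w
    unfolding h_def sum.distrib[symmetric] by (intro sum_mono) auto
  have "\<exists>U e. U \<in> \<U> \<and> e > 0 \<and> (\<forall>z\<in>topspace Y. h y z < 2 * e \<longrightarrow> z \<in> U)"
    if y: "y \<in> topspace Y" for y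
  proof -
    obtain U where U: "U \<in> \<U>" "y \<in> U" using \<U> y by (auto simp: open_cover_def)
    then have "openin Y U" using \<U> by (auto simp: open_cover_def)
    then have "compactin Y (topspace Y - U)"
      using Y by (intro closedin_compact_space) auto
    then have "compact (h y ` (topspace Y - U))"
      using image_compactin[OF _ h] by fastforce
    then have "open (- h y ` (topspace Y - U))"
      using compact_imp_closed by blast
    moreover have "0 \<in> - h y ` (topspace Y - U)"
    proof
      assume "0 \<in> h y ` (topspace Y - U)"
      then obtain z where z: "z \<in> topspace Y" "z \<notin> U" "h y z = 0" by auto
      then have "g i z = g i y" if "i \<in> I" for i
        using that I by (simp add: h_def sum_nonneg_eq_0_iff)
      then have "z = y" using inj z y by blast
      with z U show False by simp
    qed
    ultimately obtain e where e: "e > 0" "ball 0 e \<subseteq> - h y ` (topspace Y - U)"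
      using open_contains_ball by metis
    have "z \<in> U" if "z \<in> topspace Y" "h y z < 2 * (e/2)" for z
    proof (rule ccontr)
      assume "z \<notin> U"
      then have "h y z \<in> h y ` (topspace Y - U)" using that by blast
      moreover have "h y z \<ge> 0" by (simp add: h_def sum_nonneg)
      then have "h y z \<in> ball 0 e" using that by simp
      ultimately show False using e by blast
    qed
    with U e show ?thesis by (intro exI[of _ U] exI[of _ "e/2"]) auto
  qed
  then obtain U e where Ue: "\<And>y. y \<in> topspace Y \<Longrightarrow> U y \<in> \<U>" "\<And>y. y \<in> topspace Y \<Longrightarrow> (e y :: real) > 0"
    "\<And>y z. y \<in> topspace Y \<Longrightarrow> z \<in> topspace Y \<Longrightarrow> h y z < 2 * e y \<Longrightarrow> z \<in> U y"
    by metis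
  define B where "B = (\<lambda>y. {z \<in> topspace Y. h y z \<in> {..< e y}})"
  have "openin Y (B y)" for y
    unfolding B_def by (rule openin_continuous_map_preimage[OF h]) simp
  moreover have "topspace Y \<subseteq> \<Union>(B ` topspace Y)"
    using Ue(2) by (auto simp: B_def h_def)
  ultimately obtain \<F> where \<F>: "finite \<F>" "\<F> \<subseteq> B ` topspace Y" "topspace Y \<subseteq> \<Union>\<F>"
    using compactinD[of Y "topspace Y" "B ` topspace Y"] Y unfolding compact_space_def by blast
  then obtain F where F: "finite F" "F \<subseteq> topspace Y" "\<F> = B ` F"
    using finite_subset_image by metis
  define e0 where "e0 = Min (insert 1 (e ` F))"
  have e0: "e0 > 0" using F Ue(2) unfolding e0_def by (subst Min_gr_iff) auto
  have e0_le: "e0 \<le> e y" if "y \<in> F" for y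
    using F that unfolding e0_def by (intro Min_le) auto
  show ?thesis
  proof
    show "e0 / (card I + 1) > 0" using e0 by simp
    fix y assume y: "y \<in> topspace Y"
    then obtain x where x: "x \<in> F" "y \<in> B x" using \<F> F by blast
    show "\<exists>U\<in>\<U>. \<forall>z\<in>topspace Y. (\<forall>i\<in>I. \<bar>g i z - g i y\<bar> < e0 / (card I + 1)) \<longrightarrow> z \<in> U"
    proof (intro bexI ballI impI)
      fix z assume z: "z \<in> topspace Y" "\<forall>i\<in>I. \<bar>g i z - g i y\<bar> < e0 / (card I + 1)"
      then have "h y z \<le> (\<Sum>i\<in>I. e0 / (card I + 1))"
        unfolding h_def by (intro sum_mono) (auto intro: less_imp_le)
      also have "\<dots> < e0" using e0 by (simp add: field_simps)
      finally have "h x z < 2 * e x"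
        using tri[of x z y] x e0_le[OF x(1)] by (auto simp: B_def)
      then show "z \<in> U x" using Ue(3) z F x by blast
    qed (use Ue F x in auto)
  qed
qed

section \<open>The characteristic class of the sphere\<close>

text \<open>Singular chains have integral coefficients; they are paired with functions on simplices after
  reduction modulo two.\<close>

definition mod2_pairing :: "('b \<Rightarrow> bit) \<Rightarrow> ('b \<Rightarrow>\<^sub>0 int) \<Rightarrow> bit" where
  "mod2_pairing g x = (\<Sum>f\<in>Poly_Mapping.keys x. of_int (Poly_Mapping.lookup x f) * g f)"

lemma mod2_pairing_superset:
  "finite A \<Longrightarrow> Poly_Mapping.keys x \<subseteq> A \<Longrightarrow>
    mod2_pairing g x = (\<Sum>f\<in>A. of_int (Poly_Mapping.lookup x f) * g f)"
  unfolding mod2_pairing_def by (rule sum.mono_neutral_left) (auto simp: in_keys_iff)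

lemma mod2_pairing_0 [simp]: "mod2_pairing g 0 = 0"
  by (simp add: mod2_pairing_def)

lemma mod2_pairing_of [simp]: "mod2_pairing g (frag_of f) = g f"
  by (simp add: mod2_pairing_def)

lemma mod2_pairing_diff: "mod2_pairing g (x - y) = mod2_pairing g x + mod2_pairing g y"
proof -
  let ?A = "Poly_Mapping.keys x \<union> Poly_Mapping.keys y"
  have "mod2_pairing g (x - y) = (\<Sum>f\<in>?A. of_int (Poly_Mapping.lookup x f) * g f
      + of_int (Poly_Mapping.lookup y f) * g f)"
    by (subst mod2_pairing_superset[of ?A]) (auto simp: keys_diff lookup_minus distrib_right)
  also have "\<dots> = mod2_pairing g x + mod2_pairing g y"
    by (simp add: sum.distrib mod2_pairing_superset[of ?A])
  finally show ?thesis .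
qed

lemma mod2_pairing_add: "mod2_pairing g (x + y) = mod2_pairing g x + mod2_pairing g y"
proof -
  have "mod2_pairing g x = mod2_pairing g (x + y) + mod2_pairing g y" using mod2_pairing_diff[of g "x + y" y] by simp
  then show ?thesis by (simp add: add.assoc)
qed

lemma mod2_pairing_cmul: "mod2_pairing g (frag_cmul a x) = of_int a * mod2_pairing g x"
  by (subst mod2_pairing_superset[of "Poly_Mapping.keys x"])
    (auto simp: mod2_pairing_def sum_distrib_left mult.assoc keys_cmul)

lemma mod2_pairing_sum: "mod2_pairing g (\<Sum>i\<in>I. x i) = (\<Sum>i\<in>I. mod2_pairing g (x i))"
  by (induction I rule: infinite_finite_induct) (auto simp: mod2_pairing_add)

lemma mod2_pairing_cong: "(\<And>f. f \<in> Poly_Mapping.keys x \<Longrightarrow> g f = h f) \<Longrightarrow> mod2_pairing g x = mod2_pairing h x"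
  by (simp add: mod2_pairing_def)

lemma mod2_pairing_fun_add: "mod2_pairing (\<lambda>f. g f + h f) x = mod2_pairing g x + mod2_pairing h x"
  by (simp add: mod2_pairing_def sum.distrib distrib_left)

lemma of_int_sign_bit [simp]: "of_int ((-1) ^ k) = (1::bit)"
  by (induction k) auto

lemma mod2_pairing_chain_boundary:
  "mod2_pairing g (chain_boundary (Suc p) x) = mod2_pairing (\<lambda>f. \<Sum>k\<le>Suc p. g (singular_face (Suc p) k f)) x"
proof -
  have "Poly_Mapping.keys x \<subseteq> UNIV" by simp
  then show ?thesis
  proof (induction x rule: frag_induction)
    case (one f)
    then show ?case
      by (simp add: chain_boundary_of mod2_pairing_sum mod2_pairing_cmul mod2_pairing_add del: sum.atMost_Suc)
  qed (auto simp: chain_boundary_diff mod2_pairing_diff)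
qed

lemma mod2_pairing_chain_map: "mod2_pairing g (chain_map p h x) = mod2_pairing (\<lambda>f. g (simplex_map p h f)) x"
proof -
  have "Poly_Mapping.keys x \<subseteq> UNIV" by simp
  then show ?thesis
    by (induction x rule: frag_induction) (auto simp: chain_map_diff mod2_pairing_diff)
qed

text \<open>The simplex of a nerve that belongs to a singular simplex all of whose vertices have been assigned
  members \<open>W\<close> of a cover.\<close>

definition vertex_list :: "nat \<Rightarrow> ('b \<Rightarrow> 'v) \<Rightarrow> ((nat \<Rightarrow> real) \<Rightarrow> 'b) \<Rightarrow> 'v list" where
  "vertex_list p W f = map (\<lambda>i. W (f (\<lambda>j. if j = i then 1 else 0))) [0..<Suc p]"

lemma length_vertex_list [simp]: "length (vertex_list p W f) = Suc p"
  by (simp add: vertex_list_def)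

lemma simplical_face_basis:
  "simplical_face k (\<lambda>j. if j = i then 1 else (0::real)) =
    (\<lambda>j. if j = (if i < k then i else Suc i) then 1 else 0)"
  by (auto simp: simplical_face_def fun_eq_iff)

lemma vertex_list_face:
  assumes "k \<le> Suc p"
  shows "vertex_list p W (singular_face (Suc p) k f) =
    take k (vertex_list (Suc p) W f) @ drop (Suc k) (vertex_list (Suc p) W f)"
proof (rule nth_equalityI)
  fix i assume "i < length (vertex_list p W (singular_face (Suc p) k f))"
  then have i: "i \<le> p" by (simp add: vertex_list_def)
  then show "vertex_list p W (singular_face (Suc p) k f) ! i =
    (take k (vertex_list (Suc p) W f) @ drop (Suc k) (vertex_list (Suc p) W f)) ! i"
    using assms
    by (simp add: vertex_list_def singular_face_def simplical_face_basis nth_append del: upt_Suc)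
qed (use assms in auto)

lemma mod2_pairing_cobd:
  "mod2_pairing (\<lambda>f. cobd s (vertex_list (Suc p) W f)) x =
    mod2_pairing (\<lambda>f. s (vertex_list p W f)) (chain_boundary (Suc p) x)"
  unfolding mod2_pairing_chain_boundary
proof (rule mod2_pairing_cong)
  fix f
  have "cobd s (vertex_list (Suc p) W f) =
    (\<Sum>k<Suc (Suc p). s (vertex_list p W (singular_face (Suc p) k f)))"
    unfolding cobd_conv_sum by (intro sum.cong) (auto simp: vertex_list_face)
  then show "cobd s (vertex_list (Suc p) W f) =
    (\<Sum>k\<le>Suc p. s (vertex_list p W (singular_face (Suc p) k f)))"
    by (simp only: lessThan_Suc_atMost)
qed

text \<open>The reduced homology of the sphere of dimension \<open>d\<close> is concentrated in degree \<open>d\<close>. In degree zero a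
  chain represents a reduced class only if it maps to zero in a point.\<close>

lemma cycle_nsphere_is_boundary:
  assumes "p < d" and c: "singular_chain p (nsphere d) c" and bd: "chain_boundary p c = 0"
    and pt: "p = 0 \<Longrightarrow> chain_map p (\<lambda>x. ()) c = 0"
  obtains e where "singular_chain (Suc p) (nsphere d) e" "chain_boundary (Suc p) e = c"
proof -
  let ?S = "nsphere d" and ?P = "discrete_topology {()}"
  let ?c = "homologous_rel_set p ?S {} c"
  have cyc: "singular_relcycle p ?S {} c" using c bd by (simp add: singular_cycle)
  have car: "?c \<in> carrier (homology_group (int p) ?S)"
    using cyc by (auto simp: carrier_relative_homology_group)
  have "?c \<in> carrier (reduced_homology_group (int p) ?S)"
  proof (cases "p = 0")
    case True
    have "hom_induced (int p) ?S {} ?P {} (\<lambda>x. ()) ?c = homologous_rel_set p ?P {} (chain_map p (\<lambda>x. ()) c)"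
      using cyc by (intro hom_induced_chain_map) (auto simp: continuous_map_def)
    also have "\<dots> = \<one>\<^bsub>homology_group (int p) ?P\<^esub>"
      by (simp only: pt[OF True] one_relative_homology_group homologous_rel_set_eq_relboundary singular_relboundary_0)
    finally show ?thesis
      using car by (simp add: carrier_reduced_homology_group kernel_def)
  qed (use car in \<open>simp add: un_reduced_homology_group\<close>)
  then have "?c = \<one>\<^bsub>homology_group (int p) ?S\<^esub>"
    using trivial_reduced_homology_group_nsphere[of "int p" d] \<open>p < d\<close>
    by (auto simp: trivial_group_def one_reduced_homology_group)
  then have "singular_relboundary p ?S {} c"
    by (simp add: homologous_rel_set_eq_relboundary)
  then show ?thesis using that by (auto simp: singular_boundary)
qed

abbreviation antipode :: "(nat \<Rightarrow> real) \<Rightarrow> (nat \<Rightarrow> real)" where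
  "antipode x \<equiv> \<lambda>i. - x i"

lemma continuous_map_antipode: "continuous_map (nsphere d) (nsphere d) antipode"
  by (rule continuous_map_eq[OF continuous_map_antipodal_action[of d 1]])
    (simp add: antipodal_action_def)

lemma chain_map_antipode_antipode:
  "singular_chain p (nsphere d) c \<Longrightarrow> chain_map p antipode (chain_map p antipode c) = c"
proof -
  assume c: "singular_chain p (nsphere d) c"
  have "chain_map p antipode (chain_map p antipode c) = chain_map p (antipode \<circ> antipode) c"
    by (simp only: chain_map_compose comp_apply)
  also have "\<dots> = c" using c by (rule chain_map_id_gen) simp
  finally show ?thesis .
qed

text \<open>Chains with the boundary relations of the cells of the sphere that form one hemisphere in each dimension
  \<open>k\<close>; the other hemisphere is the antipodal image. The signs make the right-hand side a cycle.\<close>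

primrec hemisphere_chain :: "nat \<Rightarrow> nat \<Rightarrow> (nat \<Rightarrow> real) chain \<Rightarrow> bool" where
  "hemisphere_chain d 0 e \<longleftrightarrow> (\<exists>f. singular_simplex 0 (nsphere d) f \<and> e = frag_of f)"
| "hemisphere_chain d (Suc k) e \<longleftrightarrow> singular_chain (Suc k) (nsphere d) e \<and>
    (\<exists>e'. hemisphere_chain d k e' \<and>
      chain_boundary (Suc k) e = chain_map k antipode e' + frag_cmul ((-1) ^ Suc k) e')"

lemma hemisphere_chain_singular: "hemisphere_chain d k e \<Longrightarrow> singular_chain k (nsphere d) e"
  by (cases k) (auto simp: singular_chain_of)

text \<open>The prescribed boundary is a cycle, and the sphere has no reduced homology below its dimension.\<close>

lemma hemisphere_chain_exists: "k \<le> d \<Longrightarrow> \<exists>e. hemisphere_chain d k e"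
proof (induction k)
  case 0
  obtain x where x: "x \<in> topspace (nsphere d)" using in_topspace_nsphere by blast
  have "singular_simplex 0 (nsphere d) (restrict (\<lambda>_. x) (standard_simplex 0))"
    using x by (auto simp: singular_simplex_def)
  then show ?case by auto
next
  case (Suc k)
  then obtain e where e: "hemisphere_chain d k e" by auto
  note sing = hemisphere_chain_singular[OF e]
  define z where "z = chain_map k antipode e + frag_cmul ((-1) ^ Suc k) e"
  have z: "singular_chain k (nsphere d) z"
    unfolding z_def using sing continuous_map_antipode
    by (intro singular_chain_add singular_chain_chain_map singular_chain_cmul)
  have "chain_boundary k z = 0"
  proof (cases k)
    case (Suc j)
    then obtain e' where e': "hemisphere_chain d j e'"
      "chain_boundary k e = chain_map j antipode e' + frag_cmul ((-1) ^ k) e'"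
      using e by auto
    have "chain_boundary k (chain_map k antipode e) = chain_map j antipode (chain_boundary k e)"
      using chain_boundary_chain_map[OF sing] Suc by simp
    also have "\<dots> = e' + frag_cmul ((-1) ^ k) (chain_map j antipode e')"
      using chain_map_antipode_antipode[OF hemisphere_chain_singular[OF e'(1)]]
      by (simp add: e'(2) chain_map_add)
    finally show ?thesis
      by (cases "even k")
        (simp_all add: z_def chain_boundary_add chain_boundary_diff e'(2))
  qed (simp add: chain_boundary_def)
  moreover have "chain_map k (\<lambda>x. ()) z = 0" if "k = 0"
    using e that by (auto simp: z_def chain_map_diff simplex_map_def o_def)
  ultimately obtain e' where "singular_chain (Suc k) (nsphere d) e'" "chain_boundary (Suc k) e' = z"
    using cycle_nsphere_is_boundary[of k d z] z Suc.prems by auto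
  then show ?case using e by (auto simp: z_def)
qed


lemma singular_chain_subdivision_power:
  "singular_chain p X c \<Longrightarrow> singular_chain p X ((singular_subdivision p ^^ m) c)"
  by (induction m) (auto intro: singular_chain_singular_subdivision)

lemma chain_boundary_subdivision_power:
  "singular_chain (Suc p) X c \<Longrightarrow>
    chain_boundary (Suc p) ((singular_subdivision (Suc p) ^^ m) c) =
    (singular_subdivision p ^^ m) (chain_boundary (Suc p) c)"
  by (induction m) (auto simp: chain_boundary_singular_subdivision[OF singular_chain_subdivision_power])

lemma chain_map_subdivision_power:
  "singular_chain p X c \<Longrightarrow>
    (singular_subdivision p ^^ m) (chain_map p g c) = chain_map p g ((singular_subdivision p ^^ m) c)"
  by (induction m) (auto simp: naturality_singular_subdivision[OF singular_chain_subdivision_power])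

lemma subdivision_power_add:
  "(singular_subdivision p ^^ m) (a + b) = (singular_subdivision p ^^ m) a + (singular_subdivision p ^^ m) b"
  by (induction m) (auto simp: singular_subdivision_add)

lemma subdivision_power_cmul:
  "(singular_subdivision p ^^ m) (frag_cmul k a) = frag_cmul k ((singular_subdivision p ^^ m) a)"
  by (induction m) (auto simp: singular_subdivision_def frag_extend_cmul)

text \<open>Subdivision commutes with boundaries and with the antipodal map, and signs disappear modulo two.\<close>

lemma mod2_pairing_boundary_hemisphere_chain:
  assumes "singular_chain (Suc k) (nsphere d) e" and e': "singular_chain k (nsphere d) e'"
    and "chain_boundary (Suc k) e = chain_map k antipode e' + frag_cmul ((-1) ^ Suc k) e'"
  shows "mod2_pairing g (chain_boundary (Suc k) ((singular_subdivision (Suc k) ^^ m) e)) =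
    mod2_pairing (\<lambda>f. g f + g (simplex_map k antipode f)) ((singular_subdivision k ^^ m) e')"
  unfolding chain_boundary_subdivision_power[OF assms(1)] assms(3) subdivision_power_add
    subdivision_power_cmul chain_map_subdivision_power[OF e'] mod2_pairing_add mod2_pairing_cmul mod2_pairing_chain_map
    mod2_pairing_fun_add
  by (simp only: of_int_sign_bit mult_1 add.commute)

context free_involution
begin

lemma vertex_list_antipode:
  assumes W: "\<And>y. y \<in> topspace (nsphere d) \<Longrightarrow> W (antipode y) = t ` W y"
    and f: "singular_simplex k (nsphere d) f"
  shows "vertex_list k W (simplex_map k antipode f) = map ((`) t) (vertex_list k W f)"
proof -
  have "W (simplex_map k antipode f (\<lambda>j. if j = i then 1 else 0)) = t ` W (f (\<lambda>j. if j = i then 1 else 0))"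
    if "i \<le> k" for i
  proof -
    have "f (\<lambda>j. if j = i then 1 else 0) \<in> topspace (nsphere d)"
      using f that by (auto simp: singular_simplex_def continuous_map_def)
    then show ?thesis using W that by (simp add: simplex_map_def)
  qed
  then show ?thesis by (simp add: vertex_list_def del: upt_Suc)
qed

text \<open>By induction on \<open>k\<close>: a representative of the power \<open>k + 1\<close> is the coboundary of a lift \<open>s\<close>, so its
  value on the hemisphere of dimension \<open>k + 1\<close> is the value of \<open>s\<close> on two opposite hemispheres of
  dimension \<open>k\<close>, which is the value of \<open>(1 + t) s\<close> on one of them. Subdivision makes every simplex lie in
  a member of \<open>\<O>\<close>, so that its vertices give a simplex of the nerve; all sufficiently fine
  subdivisions are treated at once since different dimensions have to be subdivided equally often.\<close>

lemma char_cochain_hemisphere: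
  assumes W: "\<And>y. y \<in> topspace (nsphere d) \<Longrightarrow> W (antipode y) = t ` W y"
    and \<O>: "open_cover (nsphere d) \<O>"
    and small: "\<And>V ys. V \<in> \<O> \<Longrightarrow> set ys \<subseteq> V \<Longrightarrow> ys \<noteq> [] \<Longrightarrow> map W ys \<in> nerve \<W>"
  shows "hemisphere_chain d k e \<Longrightarrow> \<exists>n. \<forall>m\<ge>n.
    (\<forall>f\<in>Poly_Mapping.keys ((singular_subdivision k ^^ m) e). vertex_list k W f \<in> nerve \<W>) \<and>
    (\<forall>c. char_cochain \<W> k c \<longrightarrow>
      mod2_pairing (\<lambda>f. c (vertex_list k W f)) ((singular_subdivision k ^^ m) e) = 1)"
proof (induction k arbitrary: e)
  case 0
  then obtain f where f: "singular_simplex 0 (nsphere d) f" "e = frag_of f" by auto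
  have sub: "(singular_subdivision 0 ^^ m) e = e" for m
    using f by (induction m) (auto simp: singular_subdivision_zero[of "nsphere d"] singular_chain_of)
  let ?y = "f (\<lambda>j. if j = 0 then 1 else 0)"
  have "?y \<in> topspace (nsphere d)"
    using f by (auto simp: singular_simplex_def continuous_map_def)
  then obtain V where "V \<in> \<O>" "?y \<in> V" using \<O> by (auto simp: open_cover_def)
  then have "map W [?y] \<in> nerve \<W>" by (intro small) auto
  then show ?case unfolding sub by (auto simp: f vertex_list_def)
next
  case (Suc k)
  then obtain e' where e: "singular_chain (Suc k) (nsphere d) e" and e': "hemisphere_chain d k e'"
    and bd: "chain_boundary (Suc k) e = chain_map k antipode e' + frag_cmul ((-1) ^ Suc k) e'"
    by auto
  obtain n where n: "\<forall>m\<ge>n.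
    (\<forall>f\<in>Poly_Mapping.keys ((singular_subdivision k ^^ m) e'). vertex_list k W f \<in> nerve \<W>) \<and>
    (\<forall>c. char_cochain \<W> k c \<longrightarrow>
      mod2_pairing (\<lambda>f. c (vertex_list k W f)) ((singular_subdivision k ^^ m) e') = 1)"
    using Suc.IH[OF e'] by blast
  obtain n' where n': "\<And>m f. \<lbrakk>n' \<le> m; f \<in> Poly_Mapping.keys ((singular_subdivision (Suc k) ^^ m) e)\<rbrakk>
      \<Longrightarrow> \<exists>V \<in> \<O>. f \<in> standard_simplex (Suc k) \<rightarrow> V"
    using sufficient_iterated_singular_subdivision_exists[of \<O> "nsphere d" "Suc k" e] \<O> e
    unfolding open_cover_def by (metis order_refl)
  show ?case
  proof (intro exI allI impI)
    fix m assume m: "max n n' \<le> m"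
    let ?e = "(singular_subdivision (Suc k) ^^ m) e" and ?e' = "(singular_subdivision k ^^ m) e'"
    have nerve: "vertex_list (Suc k) W f \<in> nerve \<W>" if f: "f \<in> Poly_Mapping.keys ?e" for f
    proof -
      obtain V where V: "V \<in> \<O>" "f \<in> standard_simplex (Suc k) \<rightarrow> V" using n'[OF _ f] m by auto
      let ?ys = "map (\<lambda>i. f (\<lambda>j. if j = i then 1 else 0)) [0..<Suc (Suc k)]"
      have "set ?ys \<subseteq> V" using V by (auto simp: Pi_iff simp del: upt_Suc)
      then have "map W ?ys \<in> nerve \<W>" using V by (intro small) auto
      then show ?thesis by (simp add: vertex_list_def o_def del: upt_Suc)
    qed
    have "mod2_pairing (\<lambda>f. c (vertex_list (Suc k) W f)) ?e = 1" if c: "char_cochain \<W> (Suc k) c" for c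
    proof -
      obtain s where s: "char_cochain \<W> k (\<lambda>\<sigma>. s \<sigma> + s (map ((`) t) \<sigma>))"
        and cs: "\<And>\<sigma>. \<sigma> \<in> nerve \<W> \<Longrightarrow> length \<sigma> = k + 2 \<Longrightarrow> c \<sigma> = cobd s \<sigma>"
        using c by auto
      have "mod2_pairing (\<lambda>f. c (vertex_list (Suc k) W f)) ?e = mod2_pairing (\<lambda>f. cobd s (vertex_list (Suc k) W f)) ?e"
        by (rule mod2_pairing_cong, rule cs) (auto intro: nerve)
      also have "\<dots> = mod2_pairing (\<lambda>f. s (vertex_list k W f) + s (vertex_list k W (simplex_map k antipode f))) ?e'"
        unfolding mod2_pairing_cobd
        by (rule mod2_pairing_boundary_hemisphere_chain[OF e hemisphere_chain_singular[OF e'] bd])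
      also have "\<dots> = mod2_pairing (\<lambda>f. s (vertex_list k W f) + s (map ((`) t) (vertex_list k W f))) ?e'"
      proof (rule mod2_pairing_cong)
        fix f assume "f \<in> Poly_Mapping.keys ?e'"
        then have "singular_simplex k (nsphere d) f"
          using singular_chain_subdivision_power[OF hemisphere_chain_singular[OF e']]
          by (auto simp: singular_chain_def)
        then show "s (vertex_list k W f) + s (vertex_list k W (simplex_map k antipode f)) =
          s (vertex_list k W f) + s (map ((`) t) (vertex_list k W f))"
          by (simp add: vertex_list_antipode[where W = W, OF W])
      qed
      also have "\<dots> = 1"
      proof -
        have "\<forall>c. char_cochain \<W> k c \<longrightarrow> mod2_pairing (\<lambda>f. c (vertex_list k W f)) ?e' = 1"
          using n m by simp
        from this[rule_format, OF s] show ?thesis .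
      qed
      finally show ?thesis .
    qed
    with nerve show "(\<forall>f\<in>Poly_Mapping.keys ?e. vertex_list (Suc k) W f \<in> nerve \<W>) \<and>
      (\<forall>c. char_cochain \<W> (Suc k) c \<longrightarrow> mod2_pairing (\<lambda>f. c (vertex_list (Suc k) W f)) ?e = 1)"
      by blast
  qed
qed

text \<open>The theorem of Borsuk and Ulam in cohomological form. Points of the sphere are assigned members of the cover,
  equivariantly, such that the member assigned to \<open>y\<close> contains the images of all points near \<open>y\<close>;
  then simplices with small image have vertices in a common simplex of the nerve. On the top hemisphere a
  representative of the top power has value one, but the coboundary of an invariant cochain \<open>b\<close> has the
  value of \<open>b\<close> on two opposite hemispheres, which is zero.\<close>

lemma no_equivariant_map_if_char_power_vanishes:
  assumes van: "char_power_vanishes d" and "d \<ge> 1"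
    and f: "continuous_map (nsphere d) X f"
    and feq: "\<And>x. x \<in> topspace (nsphere d) \<Longrightarrow> f (antipode x) = t (f x)"
  shows False
proof -
  let ?S = "nsphere d"
  obtain k where d: "d = Suc k" using \<open>d \<ge> 1\<close> by (cases d) auto
  from van[unfolded char_power_vanishes_def]
  obtain \<W> c b where \<W>: "free_cover \<W>" and c: "char_cochain \<W> d c"
    and b: "\<forall>\<sigma>\<in>nerve \<W>. length \<sigma> = d \<longrightarrow> b (map ((`) t) \<sigma>) = b \<sigma>"
    and cb: "\<forall>\<sigma>\<in>nerve \<W>. length \<sigma> = Suc d \<longrightarrow> c \<sigma> = cobd b \<sigma>"
    by (elim exE conjE) (rule that)
  have S_antipode: "antipode y \<in> topspace ?S" if "y \<in> topspace ?S" for y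
    using that by (simp add: topspace_nsphere_iff)
  have fX: "f y \<in> topspace X" if "y \<in> topspace ?S" for y
    using f that by (auto simp: continuous_map_def)
  obtain r where r: "r > 0" and Leb: "\<And>y. y \<in> topspace ?S \<Longrightarrow>
      \<exists>U\<in>(\<lambda>W. {z \<in> topspace ?S. f z \<in> W}) ` \<W>.
        \<forall>z\<in>topspace ?S. (\<forall>i\<in>{..d}. \<bar>z i - y i\<bar> < r) \<longrightarrow> z \<in> U"
  proof (rule Lebesgue_number_coordinates[OF compact_space_nsphere, of "{..d}" d "\<lambda>i x. x i"])
    show "x = y" if "x \<in> topspace ?S" "y \<in> topspace ?S" "\<And>i. i \<in> {..d} \<Longrightarrow> x i = y i" for x y
    proof
      fix i show "x i = y i" using that by (cases "i \<le> d") (auto simp: topspace_nsphere_iff)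
    qed
    show "open_cover ?S ((\<lambda>W. {z \<in> topspace ?S. f z \<in> W}) ` \<W>)"
      using free_coverD(1)[OF \<W>] openin_continuous_map_preimage[OF f] fX
      by (auto simp: open_cover_def)
  qed (auto intro: continuous_map_nsphere_projection)
  obtain W0 where W0: "\<And>y. y \<in> topspace ?S \<Longrightarrow> W0 y \<in> \<W>"
    "\<And>y z. y \<in> topspace ?S \<Longrightarrow> z \<in> topspace ?S \<Longrightarrow> (\<And>i. i \<le> d \<Longrightarrow> \<bar>z i - y i\<bar> < r) \<Longrightarrow> f z \<in> W0 y"
  proof -
    have "\<forall>y\<in>topspace ?S. \<exists>W. W \<in> \<W> \<and>
        (\<forall>z\<in>topspace ?S. (\<forall>i\<le>d. \<bar>z i - y i\<bar> < r) \<longrightarrow> f z \<in> W)"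
      using Leb by fastforce
    then show ?thesis using that by (metis (no_types, lifting))
  qed
  \<comment> \<open>Points are on the sheet of the image, which distinguishes antipodes because the involution is free.\<close>
  define W where "W = (\<lambda>y. if sheet {f y} = 1 then W0 y else t ` W0 (antipode y))"
  have Weq: "W (antipode y) = t ` W y" if y: "y \<in> topspace ?S" for y
  proof -
    have "t ` {f y} \<noteq> {f y}" using free[OF fX[OF y]] by simp
    then have "sheet {f (antipode y)} = sheet {f y} + 1"
      using sheet_image[of "{f y}"] feq[OF y] by simp
    then show ?thesis by (cases "sheet {f y}") (simp_all add: W_def)
  qed
  have W: "W y \<in> \<W>" if "y \<in> topspace ?S" for y
    using that W0(1) S_antipode free_coverD(3)[OF \<W>] by (simp add: W_def)
  have fW: "f z \<in> W y" if yz: "y \<in> topspace ?S" "z \<in> topspace ?S" "\<And>i. i \<le> d \<Longrightarrow> \<bar>z i - y i\<bar> < r" for y z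
  proof -
    have "\<bar>antipode z i - antipode y i\<bar> < r" if "i \<le> d" for i
      using yz(3)[OF that] by (simp add: abs_minus_commute)
    then have "f (antipode z) \<in> W0 (antipode y)"
      by (intro W0(2) S_antipode yz)
    then have "t (t (f z)) \<in> t ` W0 (antipode y)"
      using feq[OF yz(2)] by (intro imageI) simp
    then show ?thesis
      using W0(2)[OF yz] by (simp add: W_def)
  qed
  define V where "V = (\<lambda>x. {z \<in> topspace ?S. (\<Sum>i\<le>d. \<bar>z i - x i\<bar>) \<in> {..< r / 2}})"
  have V: "\<bar>z i - x i\<bar> < r / 2" if "z \<in> V x" "i \<le> d" for x z i
  proof -
    have "\<bar>z i - x i\<bar> \<le> (\<Sum>i\<le>d. \<bar>z i - x i\<bar>)" by (rule member_le_sum) (use that in auto)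
    then show ?thesis using that by (simp add: V_def)
  qed
  have "openin ?S (V x)" for x
    unfolding V_def
    by (intro openin_continuous_map_preimage[where Y = euclideanreal] continuous_intros
        continuous_map_nsphere_projection) auto
  then have cover: "open_cover ?S (V ` topspace ?S)"
    using r by (auto simp: open_cover_def V_def)
  have small: "map W ys \<in> nerve \<W>" if A: "A \<in> V ` topspace ?S" "set ys \<subseteq> A" "ys \<noteq> []" for A ys
  proof -
    obtain x where x: "A = V x" using A by blast
    have S: "y \<in> topspace ?S" if "y \<in> set ys" for y using that A x by (auto simp: V_def)
    have hd: "hd ys \<in> set ys" using A by simp
    have "f (hd ys) \<in> W y" if "y \<in> set ys" for y
    proof (rule fW)
      fix i assume i: "i \<le> d"
      have "hd ys \<in> V x" "y \<in> V x" using A(2) x hd \<open>y \<in> set ys\<close> by auto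
      from V[OF this(1) i] V[OF this(2) i] show "\<bar>hd ys i - y i\<bar> < r" by linarith
    qed (use S hd that in auto)
    then have "f (hd ys) \<in> \<Inter>(set (map W ys))" by simp
    moreover have "set (map W ys) \<subseteq> \<W>" using W S by auto
    ultimately show ?thesis unfolding nerve_def by blast
  qed
  obtain e where e: "hemisphere_chain d d e" using hemisphere_chain_exists by blast
  then obtain e' where e1: "singular_chain (Suc k) ?S e" and e': "hemisphere_chain d k e'"
    and bd: "chain_boundary (Suc k) e = chain_map k antipode e' + frag_cmul ((-1) ^ Suc k) e'"
    using d by auto
  have hemi: "\<exists>n. \<forall>m\<ge>n.
    (\<forall>f\<in>Poly_Mapping.keys ((singular_subdivision k ^^ m) e). vertex_list k W f \<in> nerve \<W>) \<and>
    (\<forall>c. char_cochain \<W> k c \<longrightarrow>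
      mod2_pairing (\<lambda>f. c (vertex_list k W f)) ((singular_subdivision k ^^ m) e) = 1)"
    if "hemisphere_chain d k e" for k e
    by (rule char_cochain_hemisphere[where W = W and \<O> = "V ` topspace ?S"])
      (fact Weq cover small that)+
  obtain n where n: "\<forall>m\<ge>n.
    (\<forall>f\<in>Poly_Mapping.keys ((singular_subdivision d ^^ m) e). vertex_list d W f \<in> nerve \<W>) \<and>
    (\<forall>c. char_cochain \<W> d c \<longrightarrow>
      mod2_pairing (\<lambda>f. c (vertex_list d W f)) ((singular_subdivision d ^^ m) e) = 1)"
    using hemi[OF e] by blast
  obtain n' where n': "\<forall>m\<ge>n'.
    (\<forall>f\<in>Poly_Mapping.keys ((singular_subdivision k ^^ m) e'). vertex_list k W f \<in> nerve \<W>) \<and>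
    (\<forall>c. char_cochain \<W> k c \<longrightarrow>
      mod2_pairing (\<lambda>f. c (vertex_list k W f)) ((singular_subdivision k ^^ m) e') = 1)"
    using hemi[OF e'] by blast
  define m where "m = max n n'"
  have "1 = mod2_pairing (\<lambda>f. c (vertex_list d W f)) ((singular_subdivision d ^^ m) e)"
    using n c by (simp add: m_def)
  also have "\<dots> = mod2_pairing (\<lambda>f. cobd b (vertex_list d W f)) ((singular_subdivision d ^^ m) e)"
  proof (rule mod2_pairing_cong)
    fix g assume g: "g \<in> Poly_Mapping.keys ((singular_subdivision d ^^ m) e)"
    have "n \<le> m" by (simp add: m_def)
    then have "vertex_list d W g \<in> nerve \<W>" using n g by blast
    then show "c (vertex_list d W g) = cobd b (vertex_list d W g)" by (intro cb[rule_format] length_vertex_list)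
  qed
  also have "\<dots> = mod2_pairing (\<lambda>f. b (vertex_list k W f) + b (vertex_list k W (simplex_map k antipode f)))
      ((singular_subdivision k ^^ m) e')"
    unfolding d mod2_pairing_cobd using hemisphere_chain_singular[OF e'] e1 bd
    by (intro mod2_pairing_boundary_hemisphere_chain) (simp_all add: d)
  also have "\<dots> = mod2_pairing (\<lambda>f. 0) ((singular_subdivision k ^^ m) e')"
  proof (rule mod2_pairing_cong)
    fix g assume g: "g \<in> Poly_Mapping.keys ((singular_subdivision k ^^ m) e')"
    then have "singular_simplex k ?S g"
      using singular_chain_subdivision_power[OF hemisphere_chain_singular[OF e']]
      by (auto simp: singular_chain_def)
    then have "vertex_list k W (simplex_map k antipode g) = map ((`) t) (vertex_list k W g)"
      by (intro vertex_list_antipode[where W = W and d = d] Weq)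
    moreover have "n' \<le> m" by (simp add: m_def)
    then have "vertex_list k W g \<in> nerve \<W>" using g n' by blast
    then have "b (map ((`) t) (vertex_list k W g)) = b (vertex_list k W g)"
      by (intro b[rule_format]) (simp_all only: d length_vertex_list)
    ultimately show "b (vertex_list k W g) + b (vertex_list k W (simplex_map k antipode g)) = 0"
      by simp
  qed
  finally show False by (simp add: mod2_pairing_def)
qed

end

section \<open>Covering dimension of products of spheres\<close>

lemma openin_less:
  "continuous_map Y euclideanreal f \<Longrightarrow> continuous_map Y euclideanreal g \<Longrightarrow>
    openin Y {y \<in> topspace Y. f y < g y}"
  using openin_continuous_map_preimage[of Y euclideanreal "\<lambda>y. g y - f y" "{0<..}"]
  by (simp add: continuous_map_diff)

lemma openin_Ball:
  "finite A \<Longrightarrow> (\<And>i. i \<in> A \<Longrightarrow> openin Y {y \<in> topspace Y. P i y}) \<Longrightarrow>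
    openin Y {y \<in> topspace Y. \<forall>i\<in>A. P i y}"
proof (induction A rule: finite_induct)
  case (insert i A)
  have "{y \<in> topspace Y. \<forall>j\<in>insert i A. P j y} =
    {y \<in> topspace Y. P i y} \<inter> {y \<in> topspace Y. \<forall>j\<in>A. P j y}" by auto
  then show ?case using insert by auto
qed auto

text \<open>The open star of the barycenter of a cube in the integral grid, in terms of coordinates \<open>x\<close>: the
  coordinates in \<open>A\<close> are near an integer and the others lie strictly between two consecutive integers,
  each of the former being nearer to the integers than each of the latter. The open cube has dimension
  \<open>card (I - A)\<close> and is determined by \<open>A\<close> and \<open>z\<close>.\<close>

definition grid_piece ::
    "'a topology \<Rightarrow> 'i set \<Rightarrow> ('i \<Rightarrow> 'a \<Rightarrow> real) \<Rightarrow> 'i set \<Rightarrow> ('i \<Rightarrow> int) \<Rightarrow> 'a set" where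
  "grid_piece Y I x A z = {y \<in> topspace Y.
    (\<forall>i\<in>A. \<bar>x i y - z i\<bar> < 1/2) \<and> (\<forall>k\<in>I - A. z k < x k y \<and> x k y < z k + 1) \<and>
    (\<forall>i\<in>A. \<forall>k\<in>I - A. \<bar>x i y - z i\<bar> < x k y - z k \<and> \<bar>x i y - z i\<bar> < z k + 1 - x k y)}"

lemma openin_grid_piece:
  assumes "finite I" "A \<subseteq> I" and x: "\<And>i. i \<in> I \<Longrightarrow> continuous_map Y euclideanreal (x i)"
  shows "openin Y (grid_piece Y I x A z)"
proof -
  have fin: "finite A" "finite (I - A)" using assms finite_subset by auto
  have xA: "continuous_map Y euclideanreal (x i)" if "i \<in> A" for i using x that assms by auto
  have eq: "grid_piece Y I x A z = {y \<in> topspace Y. \<forall>i\<in>A. \<bar>x i y - z i\<bar> < 1/2}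
    \<inter> {y \<in> topspace Y. \<forall>k\<in>I - A. z k < x k y} \<inter> {y \<in> topspace Y. \<forall>k\<in>I - A. x k y < z k + 1}
    \<inter> {y \<in> topspace Y. \<forall>i\<in>A. \<forall>k\<in>I - A. \<bar>x i y - z i\<bar> < x k y - z k}
    \<inter> {y \<in> topspace Y. \<forall>i\<in>A. \<forall>k\<in>I - A. \<bar>x i y - z i\<bar> < z k + 1 - x k y}"
    by (auto simp: grid_piece_def)
  have near: "continuous_map Y euclideanreal (\<lambda>y. \<bar>x i y - z i\<bar>)" if "i \<in> A" for i
    by (intro continuous_map_real_abs continuous_map_diff xA that) simp
  have gap: "continuous_map Y euclideanreal (\<lambda>y. x k y - z k)"
    "continuous_map Y euclideanreal (\<lambda>y. z k + 1 - x k y)" if "k \<in> I - A" for k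
    using x that by (auto intro!: continuous_map_diff)
  show ?thesis
    unfolding eq
    by (intro openin_Int openin_Ball fin openin_less near gap) (use x in auto)
qed

text \<open>Distinct cubes of the same dimension have disjoint stars: if \<open>i\<close> is in \<open>A\<close> but not in \<open>A'\<close> and \<open>k\<close>
  the other way round, then coordinate \<open>i\<close> would be both nearer and farther from the integers than
  coordinate \<open>k\<close>.\<close>

lemma grid_pieces_disjoint:
  fixes z z' :: "'i \<Rightarrow> int"
  assumes I: "finite I" "A \<subseteq> I" "A' \<subseteq> I" and card: "card A = card A'"
    and y: "y \<in> grid_piece Y I x A z" "y \<in> grid_piece Y I x A' z'"
  shows "grid_piece Y I x A z = grid_piece Y I x A' z'"
proof -
  have near: "\<bar>x i y - of_int a\<bar> \<ge> min (x i y - of_int b) (of_int b + 1 - x i y)" for i and a b :: int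
  proof (cases "a \<le> b")
    case False
    then have "real_of_int a \<ge> of_int b + 1" by linarith
    then show ?thesis by linarith
  qed linarith
  have AA: "A = A'"
  proof (rule ccontr)
    assume ne: "A \<noteq> A'"
    have fin: "finite A" "finite A'" using I finite_subset by auto
    have "\<not> A \<subseteq> A'" "\<not> A' \<subseteq> A"
      using ne card fin card_subset_eq by metis+
    then obtain i k where ik: "i \<in> A" "i \<notin> A'" "k \<in> A'" "k \<notin> A" by blast
    then have "\<bar>x i y - z i\<bar> < x k y - z k \<and> \<bar>x i y - z i\<bar> < z k + 1 - x k y"
      "\<bar>x k y - z' k\<bar> < x i y - z' i \<and> \<bar>x k y - z' k\<bar> < z' i + 1 - x i y"
      using y I unfolding grid_piece_def by blast+
    then show False
      using near[of i "z' i" "z i"] near[of k "z k" "z' k"] by linarith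
  qed
  have zz: "z i = z' i" if "i \<in> I" for i
  proof (cases "i \<in> A")
    case True
    then have "\<bar>x i y - z i\<bar> < 1/2" "\<bar>x i y - z' i\<bar> < 1/2"
      using y AA unfolding grid_piece_def by blast+
    then show ?thesis by linarith
  next
    case False
    then have "z i < x i y \<and> x i y < z i + 1" "z' i < x i y \<and> x i y < z' i + 1"
      using y AA that unfolding grid_piece_def by blast+
    then show ?thesis by linarith
  qed
  show ?thesis
    unfolding grid_piece_def AA
    by (intro Collect_cong conj_cong ball_cong refl) (use zz I in auto)
qed

text \<open>If at every point at most \<open>N\<close> coordinates are not integers, then the space lies in the union of the cubes of
  dimension at most \<open>N\<close>. The stars of these cubes have \<open>N + 1\<close> possible dimensions and those of the same
  dimension are disjoint, hence at most \<open>N + 1\<close> of them meet. A multiple \<open>q\<close> of the coordinates makes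
  the stars small, and integral coordinates stay integral.\<close>

lemma low_order_refinement:
  fixes g :: "'i \<Rightarrow> 'a \<Rightarrow> real"
  assumes Y: "compact_space Y" and I: "finite I"
    and g: "\<And>i. i \<in> I \<Longrightarrow> continuous_map Y euclideanreal (g i)"
    and inj: "\<And>x y. x \<in> topspace Y \<Longrightarrow> y \<in> topspace Y \<Longrightarrow> (\<And>i. i \<in> I \<Longrightarrow> g i x = g i y) \<Longrightarrow> x = y"
    and dim: "\<And>y. y \<in> topspace Y \<Longrightarrow> card {i \<in> I. g i y \<notin> \<int>} \<le> N"
    and \<U>: "open_cover Y \<U>"
  obtains \<V> p where "open_cover Y \<V>" "refinement_map \<V> \<U> p"
    "\<And>\<sigma>. \<sigma> \<in> nerve \<V> \<Longrightarrow> card (set \<sigma>) \<le> Suc N"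
proof -
  obtain e where e: "e > 0" and Leb: "\<And>y. y \<in> topspace Y \<Longrightarrow>
    \<exists>U\<in>\<U>. \<forall>z\<in>topspace Y. (\<forall>i\<in>I. \<bar>g i z - g i y\<bar> < e) \<longrightarrow> z \<in> U"
  proof (rule Lebesgue_number_coordinates[of Y I g \<U>])
    show "x = y" if "x \<in> topspace Y" "y \<in> topspace Y" "\<And>i. i \<in> I \<Longrightarrow> g i x = g i y" for x y
      using that by (rule inj)
  qed (use Y I g \<U> that in auto)
  \<comment> \<open>After multiplication by \<open>q\<close> a star has diameter less than one in each coordinate.\<close>
  obtain q :: nat where q: "q > 0" "1 / q < e"
    using e by (metis nat_approx_posE of_nat_0_less_iff zero_less_Suc)
  define x where "x = (\<lambda>i y. q * g i y)"
  have x: "continuous_map Y euclideanreal (x i)" if "i \<in> I" for i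
    unfolding x_def by (intro continuous_intros g that)
  have dim': "card {i \<in> I. x i y \<notin> \<int>} \<le> N" if "y \<in> topspace Y" for y
  proof -
    have "{i \<in> I. x i y \<notin> \<int>} \<subseteq> {i \<in> I. g i y \<notin> \<int>}"
      by (auto simp: x_def)
    then have "card {i \<in> I. x i y \<notin> \<int>} \<le> card {i \<in> I. g i y \<notin> \<int>}"
      using I by (intro card_mono) auto
    with dim[OF that] show ?thesis by simp
  qed
  define \<V> where "\<V> = {V. \<exists>A z. A \<subseteq> I \<and> V = grid_piece Y I x A z \<and> V \<noteq> {}}"
  have "y \<in> \<Union>\<V>" if y: "y \<in> topspace Y" for y
  proof -
    have yV: "y \<in> grid_piece Y I x {i \<in> I. x i y \<in> \<int>} (\<lambda>i. \<lfloor>x i y\<rfloor>)" (is "y \<in> ?V")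
    proof -
      have int: "\<bar>r - \<lfloor>r\<rfloor>\<bar> = 0" if "r \<in> \<int>" for r :: real
        using that by (auto elim: Ints_cases)
      have nonint: "\<lfloor>r\<rfloor> < r \<and> r < \<lfloor>r\<rfloor> + 1" if "r \<notin> \<int>" for r :: real
        using that by (metis Ints_of_int floor_correct less_le)
      show ?thesis using y int nonint by (simp add: grid_piece_def)
    qed
    then have "?V \<in> \<V>" unfolding \<V>_def by (intro CollectI exI conjI) auto
    with yV show ?thesis by (rule UnionI[rotated])
  qed
  moreover have "openin Y V" if "V \<in> \<V>" for V
    using that openin_grid_piece[OF I _ x] by (auto simp: \<V>_def)
  ultimately have cover: "open_cover Y \<V>"
    unfolding open_cover_def using openin_subset by blast
  have "\<exists>U. U \<in> \<U> \<and> V \<subseteq> U" if V: "V \<in> \<V>" for V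
  proof -
    obtain A z where Az: "A \<subseteq> I" "V = grid_piece Y I x A z" using V by (auto simp: \<V>_def)
    obtain y where y: "y \<in> V" using V by (auto simp: \<V>_def)
    then have yY: "y \<in> topspace Y" using Az by (auto simp: grid_piece_def)
    obtain U where U: "U \<in> \<U>" "\<forall>w\<in>topspace Y. (\<forall>i\<in>I. \<bar>g i w - g i y\<bar> < e) \<longrightarrow> w \<in> U"
      using Leb[OF yY] by blast
    have "w \<in> U" if w: "w \<in> V" for w
    proof -
      have "\<bar>g i w - g i y\<bar> < e" if i: "i \<in> I" for i
      proof -
        have "\<bar>x i w - x i y\<bar> < 1"
        proof (cases "i \<in> A")
          case True
          then have "\<bar>x i w - z i\<bar> < 1/2" "\<bar>x i y - z i\<bar> < 1/2"
            using y w Az by (auto simp: grid_piece_def)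
          then show ?thesis by linarith
        next
          case False
          then have "z i < x i w \<and> x i w < z i + 1" "z i < x i y \<and> x i y < z i + 1"
            using y w Az i unfolding grid_piece_def by blast+
          then show ?thesis by linarith
        qed
        then have "q * \<bar>g i w - g i y\<bar> < 1"
          by (simp add: x_def abs_mult flip: right_diff_distrib)
        then have "\<bar>g i w - g i y\<bar> < 1 / q" using q by (simp add: field_simps)
        then show ?thesis using q by simp
      qed
      then show ?thesis using U w Az by (auto simp: grid_piece_def)
    qed
    then show ?thesis using U by blast
  qed
  then obtain p where p: "refinement_map \<V> \<U> p"
    unfolding refinement_map_def by metis
  have "card (set \<sigma>) \<le> Suc N" if \<sigma>: "\<sigma> \<in> nerve \<V>" for \<sigma>
  proof -
    obtain y where y: "y \<in> \<Inter>(set \<sigma>)" using \<sigma> by (auto simp: nerve_def)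
    have "\<forall>V\<in>set \<sigma>. \<exists>A z. A \<subseteq> I \<and> V = grid_piece Y I x A z"
      using \<sigma> by (auto simp: nerve_def \<V>_def)
    then obtain A z where Az: "\<And>V. V \<in> set \<sigma> \<Longrightarrow> A V \<subseteq> I" "\<And>V. V \<in> set \<sigma> \<Longrightarrow> V = grid_piece Y I x (A V) (z V)"
      by metis
    have "card (I - A V) \<le> N" if V: "V \<in> set \<sigma>" for V
    proof -
      have yV: "y \<in> grid_piece Y I x (A V) (z V)" using y Az(2)[OF V] V by blast
      have "I - A V \<subseteq> {i \<in> I. x i y \<notin> \<int>}"
      proof
        fix k assume k: "k \<in> I - A V"
        then have "z V k < x k y \<and> x k y < z V k + 1"
          using yV unfolding grid_piece_def by blast
        then have "x k y \<notin> \<int>" by (auto elim!: Ints_cases)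
        then show "k \<in> {i \<in> I. x i y \<notin> \<int>}" using k by simp
      qed
      then have "card (I - A V) \<le> card {i \<in> I. x i y \<notin> \<int>}" using I by (intro card_mono) auto
      moreover have "y \<in> topspace Y" using yV by (simp add: grid_piece_def)
      ultimately show ?thesis using dim' by fastforce
    qed
    \<comment> \<open>Members that meet are distinguished by the dimensions of their cubes.\<close>
    then have "(\<lambda>V. card (I - A V)) ` set \<sigma> \<subseteq> {..N}" by auto
    moreover have "inj_on (\<lambda>V. card (I - A V)) (set \<sigma>)"
    proof (rule inj_onI)
      fix V W assume VW: "V \<in> set \<sigma>" "W \<in> set \<sigma>" "card (I - A V) = card (I - A W)"
      have "card (A V) \<le> card I" "card (A W) \<le> card I"
        using Az(1) VW I by (auto intro: card_mono)
      moreover have "card (I - A V) = card I - card (A V)" "card (I - A W) = card I - card (A W)"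
        using Az(1) VW I by (metis card_Diff_subset finite_subset)+
      ultimately have "card (A V) = card (A W)" using VW(3) by linarith
      then have "grid_piece Y I x (A V) (z V) = grid_piece Y I x (A W) (z W)"
        using I Az VW y by (intro grid_pieces_disjoint[of I _ _ y]) blast+
      then show "V = W" using Az VW by metis
    qed
    ultimately have "card (set \<sigma>) \<le> card {..N}"
      by (metis card_inj_on_le finite_atMost)
    then show ?thesis by simp
  qed
  with cover p show ?thesis using that by blast
qed

lemma cech_vanishes_low_order:
  assumes "\<And>\<U>. open_cover Y \<U> \<Longrightarrow> \<exists>\<V> p. open_cover Y \<V> \<and> refinement_map \<V> \<U> p \<and>
    (\<forall>\<sigma>\<in>nerve \<V>. card (set \<sigma>) \<le> Suc N)"
    and "k > N"
  shows "cech_vanishes Y k"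
  unfolding cech_vanishes_def
proof (intro allI impI)
  fix \<U> and c :: "'a set list \<Rightarrow> bit"
  assume "open_cover Y \<U> \<and> (\<forall>\<sigma>\<in>nerve \<U>. length \<sigma> = k + 2 \<longrightarrow> cobd c \<sigma> = 0)"
  then have \<U>: "open_cover Y \<U>" and c: "\<And>\<sigma>. \<sigma> \<in> nerve \<U> \<Longrightarrow> length \<sigma> = k + 2 \<Longrightarrow> cobd c \<sigma> = 0"
    by auto
  obtain \<V> p where \<V>: "open_cover Y \<V>" and p: "refinement_map \<V> \<U> p"
    and N: "\<forall>\<sigma>\<in>nerve \<V>. card (set \<sigma>) \<le> Suc N"
    using assms(1)[OF \<U>] by blast
  have dim: "\<not> distinct \<sigma>" if "\<sigma> \<in> nerve \<V>" "length \<sigma> = Suc k" for \<sigma>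
    using N that \<open>k > N\<close> distinct_card[of \<sigma>] by fastforce
  have cp: "cobd (\<lambda>\<sigma>. c (map p \<sigma>)) \<sigma> = 0" if "\<sigma> \<in> nerve \<V>" "length \<sigma> = Suc (Suc k)" for \<sigma>
    using c[OF nerve_map[OF p that(1)]] that(2) by (simp add: cobd_map)
  obtain a where "\<And>\<sigma>. \<sigma> \<in> nerve \<V> \<Longrightarrow> length \<sigma> = Suc k \<Longrightarrow> c (map p \<sigma>) = cobd a \<sigma>"
    by (rule cocycle_above_dimension[of "nerve \<V>" id "Suc k" "\<lambda>\<sigma>. c (map p \<sigma>)" id])
      (use ordered_complex_nerve dim cp in auto)
  with \<V> p show "\<exists>\<V> p a. open_cover Y \<V> \<and> refinement_map \<V> \<U> p \<and>
      (\<forall>\<sigma>\<in>nerve \<V>. length \<sigma> = Suc k \<longrightarrow> c (map p \<sigma>) = cobd a \<sigma>)"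
    by blast
qed

text \<open>Radial projection of the round sphere to the boundary of the cube given by coordinates between \<open>-1\<close> and \<open>1\<close>, where at
  every point some coordinate is an integer.\<close>

definition sup_normalized :: "nat \<Rightarrow> nat \<Rightarrow> (nat \<Rightarrow> real) \<Rightarrow> real" where
  "sup_normalized n i x = x i / Max ((\<lambda>j. \<bar>x j\<bar>) ` {..n})"

lemma continuous_map_Max:
  assumes "finite A" "A \<noteq> {}" "\<And>i. i \<in> A \<Longrightarrow> continuous_map Y euclideanreal (f i)"
  shows "continuous_map Y euclideanreal (\<lambda>y. Max ((\<lambda>i. f i y) ` A))"
  using assms
proof (induction A rule: finite_ne_induct)
  case (insert i A)
  then have "continuous_map Y euclideanreal (\<lambda>y. max (f i y) (Max ((\<lambda>i. f i y) ` A)))"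
    by (intro continuous_map_real_max) auto
  then show ?case using insert by simp
qed auto

lemma sup_nsphere_pos:
  assumes "x \<in> topspace (nsphere n)"
  shows "Max ((\<lambda>j. \<bar>x j\<bar>) ` {..n}) > 0"
proof (rule ccontr)
  assume neg: "\<not> ?thesis"
  have "\<bar>x j\<bar> \<le> 0" if "j \<le> n" for j
  proof -
    have "\<bar>x j\<bar> \<le> Max ((\<lambda>j. \<bar>x j\<bar>) ` {..n})" by (rule Max_ge) (use that in auto)
    with neg show ?thesis by linarith
  qed
  then have "(\<Sum>i\<le>n. x i ^ 2) = 0" by simp
  with assms show False by (simp add: topspace_nsphere_iff)
qed

lemma continuous_map_sup_normalized:
  "continuous_map (nsphere n) euclideanreal (sup_normalized n i)"
  unfolding sup_normalized_def
  by (intro continuous_map_real_divide continuous_map_Max continuous_map_real_abs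
      continuous_map_nsphere_projection) (use sup_nsphere_pos in fastforce)+

lemma sup_normalized_inj:
  assumes x: "x \<in> topspace (nsphere n)" and y: "y \<in> topspace (nsphere n)"
    and eq: "\<And>i. i \<le> n \<Longrightarrow> sup_normalized n i x = sup_normalized n i y"
  shows "x = y"
proof -
  define a b where "a = Max ((\<lambda>j. \<bar>x j\<bar>) ` {..n})" and "b = Max ((\<lambda>j. \<bar>y j\<bar>) ` {..n})"
  have pos: "a > 0" "b > 0" using sup_nsphere_pos x y by (auto simp: a_def b_def)
  define r where "r = a / b"
  have xi: "x i = r * y i" if "i \<le> n" for i
    using eq[OF that] pos by (simp add: sup_normalized_def r_def a_def[symmetric] b_def[symmetric] field_simps)
  have "1 = (\<Sum>i\<le>n. x i ^ 2)" using x by (simp add: topspace_nsphere_iff)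
  also have "\<dots> = r ^ 2 * (\<Sum>i\<le>n. y i ^ 2)"
    by (simp add: xi power_mult_distrib sum_distrib_left)
  also have "\<dots> = r ^ 2" using y by (simp add: topspace_nsphere_iff)
  finally have "r = 1" using pos by (simp add: r_def power2_eq_1_iff) (smt (verit) divide_pos_pos)
  show ?thesis
  proof
    fix i show "x i = y i"
      using xi x y \<open>r = 1\<close> by (cases "i \<le> n") (auto simp: topspace_nsphere_iff)
  qed
qed

lemma card_sup_normalized_not_Ints:
  assumes "x \<in> topspace (nsphere n)"
  shows "card {i \<in> {..n}. sup_normalized n i x \<notin> \<int>} \<le> n"
proof -
  have "Max ((\<lambda>j. \<bar>x j\<bar>) ` {..n}) \<in> (\<lambda>j. \<bar>x j\<bar>) ` {..n}" by (intro Max_in) auto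
  then obtain j where "Max ((\<lambda>j. \<bar>x j\<bar>) ` {..n}) = \<bar>x j\<bar>" "j \<in> {..n}" by (rule imageE)
  then have j: "j \<le> n" "\<bar>x j\<bar> = Max ((\<lambda>j. \<bar>x j\<bar>) ` {..n})" by simp_all
  then have "sup_normalized n j x = x j / \<bar>x j\<bar>" by (simp add: sup_normalized_def)
  moreover have "x j \<noteq> 0" using sup_nsphere_pos[OF assms] j by auto
  ultimately have "sup_normalized n j x \<in> \<int>" by (cases "x j > 0") auto
  then have "{i \<in> {..n}. sup_normalized n i x \<notin> \<int>} \<subseteq> {..n} - {j}" by auto
  then have "card {i \<in> {..n}. sup_normalized n i x \<notin> \<int>} \<le> card ({..n} - {j})"
    by (intro card_mono) auto
  with j show ?thesis by simp
qed

text \<open>The product of spheres embeds in the product of the boundaries of cubes, in which each factor has an integral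
  coordinate at every point; this leaves at most \<open>n + m + l\<close> coordinates that are not integers.\<close>

lemma cech_vanishes_product_of_spheres:
  assumes "k > n + m + l"
  shows "cech_vanishes (prod_topology (nsphere n) (prod_topology (nsphere m) (nsphere l))) k"
proof (rule cech_vanishes_low_order[OF _ assms])
  let ?Y = "prod_topology (nsphere n) (prod_topology (nsphere m) (nsphere l))"
  define I :: "(nat + nat + nat) set" where "I = Inl ` {..n} \<union> Inr ` (Inl ` {..m} \<union> Inr ` {..l})"
  define g :: "nat + nat + nat \<Rightarrow> (nat \<Rightarrow> real) \<times> (nat \<Rightarrow> real) \<times> (nat \<Rightarrow> real) \<Rightarrow> real"
    where "g = (\<lambda>j y. case j of Inl i \<Rightarrow> sup_normalized n i (fst y)
      | Inr (Inl i) \<Rightarrow> sup_normalized m i (fst (snd y))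
      | Inr (Inr i) \<Rightarrow> sup_normalized l i (snd (snd y)))"
  have cont: "continuous_map ?Y euclideanreal (g j)" for j
  proof -
    have 1: "continuous_map ?Y (nsphere n) fst" by (rule continuous_map_fst)
    have 2: "continuous_map ?Y (nsphere m) (\<lambda>y. fst (snd y))"
      using continuous_map_compose[OF continuous_map_snd continuous_map_fst] by (simp add: o_def)
    have 3: "continuous_map ?Y (nsphere l) (\<lambda>y. snd (snd y))"
      using continuous_map_compose[OF continuous_map_snd continuous_map_snd] by (simp add: o_def)
    note comps = continuous_map_compose[OF 1 continuous_map_sup_normalized]
      continuous_map_compose[OF 2 continuous_map_sup_normalized]
      continuous_map_compose[OF 3 continuous_map_sup_normalized]
    consider i where "j = Inl i" | i where "j = Inr (Inl i)" | i where "j = Inr (Inr i)"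
      by (metis sum.exhaust)
    then show ?thesis
      using comps by cases (simp_all add: g_def o_def)
  qed
  fix \<U> assume \<U>: "open_cover ?Y \<U>"
  show "\<exists>\<V> p. open_cover ?Y \<V> \<and> refinement_map \<V> \<U> p \<and>
    (\<forall>\<sigma>\<in>nerve \<V>. card (set \<sigma>) \<le> Suc (n + m + l))"
  proof (rule low_order_refinement[of ?Y I g "n + m + l" \<U>])
    show "compact_space ?Y" by (simp add: compact_space_prod_topology compact_space_nsphere)
    show "finite I" by (simp add: I_def)
    show "continuous_map ?Y euclideanreal (g i)" for i by (rule cont)
    show "open_cover ?Y \<U>" by (rule \<U>)
    fix y assume y: "y \<in> topspace ?Y"
    then obtain a b c where abc: "y = (a, b, c)" "a \<in> topspace (nsphere n)"
      "b \<in> topspace (nsphere m)" "c \<in> topspace (nsphere l)" by auto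
    show "y = y'" if y': "y' \<in> topspace ?Y" and eq: "\<And>i. i \<in> I \<Longrightarrow> g i y = g i y'" for y'
    proof -
      obtain a' b' c' where abc': "y' = (a', b', c')" "a' \<in> topspace (nsphere n)"
        "b' \<in> topspace (nsphere m)" "c' \<in> topspace (nsphere l)" using y' by auto
      have "a = a'"
        by (rule sup_normalized_inj[OF abc(2) abc'(2)])
          (use eq[of "Inl _"] in \<open>auto simp: I_def g_def abc(1) abc'(1)\<close>)
      moreover have "b = b'"
        by (rule sup_normalized_inj[OF abc(3) abc'(3)])
          (use eq[of "Inr (Inl _)"] in \<open>auto simp: I_def g_def abc(1) abc'(1)\<close>)
      moreover have "c = c'"
        by (rule sup_normalized_inj[OF abc(4) abc'(4)])
          (use eq[of "Inr (Inr _)"] in \<open>auto simp: I_def g_def abc(1) abc'(1)\<close>)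
      ultimately show ?thesis by (simp add: abc(1) abc'(1))
    qed
    let ?A = "{i \<in> {..n}. sup_normalized n i a \<notin> \<int>}"
    let ?B = "{i \<in> {..m}. sup_normalized m i b \<notin> \<int>}"
    let ?C = "{i \<in> {..l}. sup_normalized l i c \<notin> \<int>}"
    let ?A' = "Inl ` ?A :: (nat + nat + nat) set" and ?B' = "Inr ` Inl ` ?B :: (nat + nat + nat) set"
      and ?C' = "Inr ` Inr ` ?C :: (nat + nat + nat) set"
    have "{i \<in> I. g i y \<notin> \<int>} \<subseteq> ?A' \<union> (?B' \<union> ?C')"
      by (auto simp: I_def g_def abc(1))
    then have "card {i \<in> I. g i y \<notin> \<int>} \<le> card (?A' \<union> (?B' \<union> ?C'))"
      by (intro card_mono) auto
    also have "\<dots> \<le> card ?A' + (card ?B' + card ?C')"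
      using card_Un_le[of ?A' "?B' \<union> ?C'"] card_Un_le[of ?B' ?C'] by linarith
    also have "\<dots> = card ?A + (card ?B + card ?C)"
      by (simp add: card_image image_image inj_on_def)
    also have "\<dots> \<le> n + (m + l)"
      by (intro add_mono card_sup_normalized_not_Ints abc)
    finally show "card {i \<in> I. g i y \<notin> \<int>} \<le> n + m + l" by simp
  qed blast
qed

section \<open>The cohomology of a space equivalent to a product of spheres\<close>

lemma nerve_simplices_eq: "nerve_simplices \<U> k = {\<sigma> \<in> nerve \<U>. length \<sigma> = Suc k}"
  by (auto simp: nerve_simplices_def nerve_def)

lemma coboundary_eq_cobd: "\<sigma> \<in> nerve_simplices \<U> (Suc k) \<Longrightarrow> coboundary \<U> k c \<sigma> = cobd c \<sigma>"
  by (simp add: coboundary_def cobd_conv_sum nerve_simplices_eq lessThan_Suc_atMost del: sum.atMost_Suc)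

lemma cocycles_iff:
  "c \<in> cocycles \<U> k \<longleftrightarrow> c \<in> cochains \<U> k \<and> (\<forall>\<sigma>\<in>nerve \<U>. length \<sigma> = k + 2 \<longrightarrow> cobd c \<sigma> = 0)"
proof -
  have "coboundary \<U> k c = (\<lambda>\<sigma>. 0) \<longleftrightarrow> (\<forall>\<sigma>\<in>nerve_simplices \<U> (Suc k). cobd c \<sigma> = 0)"
    by (metis (no_types, lifting) coboundary_def coboundary_eq_cobd)
  then show ?thesis by (auto simp: cocycles_def nerve_simplices_eq)
qed

text \<open>A function on all lists can be truncated to the nerve, which changes its coboundary nowhere on the nerve.\<close>

lemma coboundaries_iff:
  "c \<in> coboundaries \<U> (Suc k) \<longleftrightarrow> c \<in> cochains \<U> (Suc k) \<and>
    (\<exists>a. \<forall>\<sigma>\<in>nerve \<U>. length \<sigma> = k + 2 \<longrightarrow> c \<sigma> = cobd a \<sigma>)" (is "_ \<longleftrightarrow> ?R")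
proof
  assume "c \<in> coboundaries \<U> (Suc k)"
  then obtain a where "c = coboundary \<U> k a" by (auto simp: coboundaries_def)
  moreover have "coboundary \<U> k a \<sigma> = 0" if "\<sigma> \<notin> nerve_simplices \<U> (Suc k)" for \<sigma>
    using that by (simp add: coboundary_def)
  ultimately show ?R
    by (auto simp: cochains_def nerve_simplices_eq coboundary_eq_cobd intro!: exI[of _ a])
next
  assume ?R
  then obtain a where c: "c \<in> cochains \<U> (Suc k)"
    and a: "\<And>\<sigma>. \<sigma> \<in> nerve_simplices \<U> (Suc k) \<Longrightarrow> c \<sigma> = cobd a \<sigma>"
    by (auto simp: nerve_simplices_eq)
  define a' where "a' = (\<lambda>\<sigma>. if \<sigma> \<in> nerve_simplices \<U> k then a \<sigma> else 0)"
  have "c \<sigma> = coboundary \<U> k a' \<sigma>" for \<sigma>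
  proof (cases "\<sigma> \<in> nerve_simplices \<U> (Suc k)")
    case True
    then have "cobd a \<sigma> = cobd a' \<sigma>"
      by (intro cobd_cong[OF ordered_complex_nerve[of \<U>]]) (auto simp: nerve_simplices_eq a'_def)
    then show ?thesis using True by (simp add: a coboundary_eq_cobd)
  next
    case False
    then show ?thesis using c by (simp add: cochains_def coboundary_def)
  qed
  then have "c = coboundary \<U> k a'" by (rule ext)
  moreover have "a' \<in> cochains \<U> k" by (simp add: cochains_def a'_def)
  ultimately show "c \<in> coboundaries \<U> (Suc k)"
    unfolding coboundaries_def by (simp only: nat.case image_eqI)
qed

lemma common_refinement:
  assumes "open_cover X \<U>" "open_cover X \<V>"
  obtains \<W> p q where "open_cover X \<W>" "refinement_map \<W> \<U> p" "refinement_map \<W> \<V> q"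
proof -
  define \<W> where "\<W> = (\<lambda>(U, V). U \<inter> V) ` (\<U> \<times> \<V>)"
  have "\<Union>\<W> = \<Union>\<U> \<inter> \<Union>\<V>" by (auto simp: \<W>_def)
  then have "open_cover X \<W>"
    using assms by (auto simp: open_cover_def \<W>_def)
  moreover have "\<forall>W\<in>\<W>. \<exists>U. U \<in> \<U> \<and> W \<subseteq> U"
    unfolding \<W>_def by (auto intro: Int_lower1)
  then obtain p where "refinement_map \<W> \<U> p" unfolding refinement_map_def by metis
  moreover have "\<forall>W\<in>\<W>. \<exists>V. V \<in> \<V> \<and> W \<subseteq> V"
    unfolding \<W>_def by (auto intro: Int_lower2)
  then obtain q where "refinement_map \<W> \<V> q" unfolding refinement_map_def by metis
  ultimately show ?thesis by (rule that)
qed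

text \<open>Any two classes become equal on a refinement, as their difference is a coboundary there.\<close>

lemma cech_rel_trivial:
  assumes van: "cech_vanishes Y (Suc k)"
  shows "cech_rel Y (Suc k) = cech_reps Y (Suc k) \<times> cech_reps Y (Suc k)"
proof -
  have "\<exists>\<W> p q. open_cover Y \<W> \<and> refinement_map \<W> \<U> p \<and> refinement_map \<W> \<V> q \<and>
      cochain_add (cochain_pullback \<W> (Suc k) p c) (cochain_pullback \<W> (Suc k) q d) \<in> coboundaries \<W> (Suc k)"
    if c: "open_cover Y \<U>" "c \<in> cocycles \<U> (Suc k)" and d: "open_cover Y \<V>" "d \<in> cocycles \<V> (Suc k)"
    for \<U> \<V> c d
  proof -
    obtain \<W> p q where \<W>: "open_cover Y \<W>" and p: "refinement_map \<W> \<U> p" and q: "refinement_map \<W> \<V> q"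
      using common_refinement[OF c(1) d(1)] .
    let ?e = "\<lambda>\<sigma>. c (map p \<sigma>) + d (map q \<sigma>)"
    have e: "cobd ?e \<sigma> = 0" if "\<sigma> \<in> nerve \<W>" "length \<sigma> = Suc k + 2" for \<sigma>
    proof -
      have "cobd c (map p \<sigma>) = 0" "cobd d (map q \<sigma>) = 0"
        using c(2) d(2) nerve_map[OF p that(1)] nerve_map[OF q that(1)] that(2)
        by (simp_all add: cocycles_iff)
      then show ?thesis by (simp add: cobd_add cobd_map)
    qed
    obtain \<W>' r a where \<W>': "open_cover Y \<W>'" and r: "refinement_map \<W>' \<W> r"
      and a: "\<forall>\<sigma>\<in>nerve \<W>'. length \<sigma> = Suc (Suc k) \<longrightarrow> ?e (map r \<sigma>) = cobd a \<sigma>"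
      using van[unfolded cech_vanishes_def, rule_format, of \<W> ?e] \<W> e by blast
    have "refinement_map \<W>' \<U> (p \<circ> r)" "refinement_map \<W>' \<V> (q \<circ> r)"
      using p q r unfolding refinement_map_def by fastforce+
    moreover have "cochain_add (cochain_pullback \<W>' (Suc k) (p \<circ> r) c)
        (cochain_pullback \<W>' (Suc k) (q \<circ> r) d) \<in> coboundaries \<W>' (Suc k)"
      unfolding coboundaries_iff
      using a by (auto simp: cochain_add_def cochain_pullback_def cochains_def nerve_simplices_eq
          intro!: exI[of _ a])
    ultimately show ?thesis using \<W>' by blast
  qed
  then show ?thesis by (auto simp: cech_rel_def cech_reps_def)
qed

lemma open_cover_topspace: "open_cover X {topspace X}"
  by (simp add: open_cover_def)

lemma zero_cocycle: "(\<lambda>\<sigma>. 0) \<in> cocycles \<U> k"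
  by (simp add: cocycles_iff cochains_def cobd_def)

text \<open>By the isomorphism, \<open>X\<close> has only one class in this degree, so that a cocycle is related to zero.\<close>

lemma cech_vanishes_transfer:
  assumes XY: "X \<sim>\<^sub>2 Y" and van: "cech_vanishes Y (Suc k)"
  shows "cech_vanishes X (Suc k)"
  unfolding cech_vanishes_def
proof (intro allI impI)
  fix \<U> and c :: "'a set list \<Rightarrow> bit"
  assume "open_cover X \<U> \<and> (\<forall>\<sigma>\<in>nerve \<U>. length \<sigma> = Suc k + 2 \<longrightarrow> cobd c \<sigma> = 0)"
  then have \<U>: "open_cover X \<U>" and c: "\<And>\<sigma>. \<sigma> \<in> nerve \<U> \<Longrightarrow> length \<sigma> = Suc k + 2 \<Longrightarrow> cobd c \<sigma> = 0"
    by auto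
  let ?k = "Suc k"
  let ?K = "cech_rel X ?k" and ?z = "({topspace X}, \<lambda>\<sigma>::'a set list. 0::bit)"
  obtain \<Phi> where "\<Phi> \<in> iso (cech_group X ?k) (cech_group Y ?k)"
    using XY unfolding cech_equivalent_def cech_graded_ring_iso_def by blast
  then have inj: "inj_on \<Phi> (cech_cohomology X ?k)" and im: "\<Phi> ` cech_cohomology X ?k = cech_cohomology Y ?k"
    by (auto simp: iso_def bij_betw_def cech_group_def)
  have "a = b" if "a \<in> cech_cohomology Y ?k" "b \<in> cech_cohomology Y ?k" for a b
    using that by (auto simp: cech_cohomology_def quotient_def cech_rel_trivial[OF van])
  then have single: "a = b" if "a \<in> cech_cohomology X ?k" "b \<in> cech_cohomology X ?k" for a b
    using that inj im by (metis imageI inj_onD)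
  define c' where "c' = (\<lambda>\<sigma>. if \<sigma> \<in> nerve_simplices \<U> ?k then c \<sigma> else 0)"
  have "cobd c' \<sigma> = 0" if "\<sigma> \<in> nerve \<U>" "length \<sigma> = ?k + 2" for \<sigma>
    using c[OF that] that
    by (subst cobd_cong[OF ordered_complex_nerve that(1), of _ c]) (auto simp: c'_def nerve_simplices_eq)
  then have c': "c' \<in> cocycles \<U> ?k"
    by (auto simp: cocycles_iff cochains_def c'_def)
  have reps: "(\<U>, c') \<in> cech_reps X ?k" "?z \<in> cech_reps X ?k"
    using \<U> c' open_cover_topspace zero_cocycle by (auto simp: cech_reps_def)
  have "refinement_map {topspace X} {topspace X} id" by (simp add: refinement_map_def)
  moreover have "cochain_add (cochain_pullback {topspace X} ?k id (\<lambda>\<sigma>. 0))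
      (cochain_pullback {topspace X} ?k id (\<lambda>\<sigma>. 0)) \<in> coboundaries {topspace X} ?k"
    by (auto simp: coboundaries_iff cochain_add_def cochain_pullback_def cochains_def cobd_def
        intro!: exI[of _ "\<lambda>\<sigma>. 0"])
  ultimately have "(?z, ?z) \<in> ?K"
    using reps(2) open_cover_topspace unfolding cech_rel_def by blast
  moreover have "?K `` {(\<U>, c')} = ?K `` {?z}"
    using reps by (intro single) (auto simp: cech_cohomology_def quotient_def)
  ultimately have "((\<U>, c'), ?z) \<in> ?K" by blast
  then obtain \<W> p q where \<W>: "open_cover X \<W>" and p: "refinement_map \<W> \<U> p"
    and b: "cochain_add (cochain_pullback \<W> ?k p c') (cochain_pullback \<W> ?k q (\<lambda>\<sigma>. 0)) \<in> coboundaries \<W> ?k"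
    by (auto simp: cech_rel_def)
  then obtain a where a: "\<And>\<sigma>. \<sigma> \<in> nerve \<W> \<Longrightarrow> length \<sigma> = k + 2 \<Longrightarrow>
      cochain_add (cochain_pullback \<W> ?k p c') (cochain_pullback \<W> ?k q (\<lambda>\<sigma>. 0)) \<sigma> = cobd a \<sigma>"
    unfolding coboundaries_iff by blast
  have "c (map p \<sigma>) = cobd a \<sigma>" if "\<sigma> \<in> nerve \<W>" "length \<sigma> = Suc ?k" for \<sigma>
    using a[OF that(1)] that(2) nerve_map[OF p that(1)]
    by (simp add: cochain_add_def cochain_pullback_def c'_def nerve_simplices_eq that(1))
  with \<W> p show "\<exists>\<V> p a. open_cover X \<V> \<and> refinement_map \<V> \<U> p \<and>
      (\<forall>\<sigma>\<in>nerve \<V>. length \<sigma> = Suc ?k \<longrightarrow> c (map p \<sigma>) = cobd a \<sigma>)"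
    by blast
qed

section \<open>Equivariant maps from spheres\<close>

text \<open>The generator of the group acts as an involution on the space, and is extended by the identity to all points.\<close>

lemma involution_of_action:
  fixes X :: "'a topology"
  assumes H: "Hausdorff_space X" and act: "free_continuous_action (integer_mod_group 2) X \<phi>"
  defines "t \<equiv> \<lambda>x. if x \<in> topspace X then \<phi> 1 x else x"
  shows "free_involution X t"
proof -
  have ga: "group_action (integer_mod_group 2) (topspace X) \<phi>"
    and cont: "continuous_map X X (\<phi> 1)"
    and fr: "\<And>x. x \<in> topspace X \<Longrightarrow> \<phi> 1 x \<noteq> x"
    using act unfolding free_continuous_action_def continuous_action_def
    by (auto simp: carrier_integer_mod_group)
  have "\<phi> 1 (\<phi> 1 x) = x" if x: "x \<in> topspace X" for x
  proof -
    have one: "(1::int) \<in> carrier (integer_mod_group 2)" by (simp add: carrier_integer_mod_group)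
    have "\<phi> 1 (\<phi> 1 x) = \<phi> (1 \<otimes>\<^bsub>integer_mod_group 2\<^esub> 1) x"
      using group_action.composition_rule[OF ga x one one] by simp
    also have "1 \<otimes>\<^bsub>integer_mod_group 2\<^esub> 1 = \<one>\<^bsub>integer_mod_group 2\<^esub>" by simp
    also have "\<phi> \<one>\<^bsub>integer_mod_group 2\<^esub> x = x"
      using group_action.id_eq_one[OF ga] x by (metis restrict_apply')
    finally show ?thesis .
  qed
  moreover have "\<phi> 1 x \<in> topspace X" if "x \<in> topspace X" for x
    using cont that by (auto simp: continuous_map_def)
  ultimately show ?thesis
    using H fr cont continuous_map_eq[OF cont, of t]
    unfolding t_def by unfold_locales auto
qed

theorem proposition4p1:
  fixes X :: "'a topology" and \<phi> :: "int \<Rightarrow> 'a \<Rightarrow> 'a" and n m l :: nat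
  assumes "finitistic_space X"
    and "free_continuous_action (integer_mod_group 2) X \<phi>"
    and "X \<sim>\<^sub>2 prod_topology (nsphere n) (prod_topology (nsphere m) (nsphere l))"
    and "1 \<le> n" and "n \<le> m" and "m \<le> l"
  shows "\<exists>h\<in>{n, m, l, n + m, 2 * n + l, n + l, m + l, n + m + l}. \<forall>d>h.
    \<not> (\<exists>f. equivariant_map (integer_mod_group 2) (nsphere d) (antipodal_action d) X \<phi> f)"
proof (intro bexI allI impI notI)
  fix d assume d: "d > n + m + l"
    and "\<exists>f. equivariant_map (integer_mod_group 2) (nsphere d) (antipodal_action d) X \<phi> f"
  then obtain f where f: "continuous_map (nsphere d) X f"
    and feq: "\<And>x. x \<in> topspace (nsphere d) \<Longrightarrow> f (antipodal_action d 1 x) = \<phi> 1 (f x)"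
    by (auto simp: equivariant_map_def carrier_integer_mod_group)
  define t where "t = (\<lambda>x. if x \<in> topspace X then \<phi> 1 x else x)"
  interpret free_involution X t
    unfolding t_def using assms(1,2) by (intro involution_of_action) (auto simp: finitistic_space_def)
  have "cech_vanishes X k" if "k > n + m + l" for k
    using cech_vanishes_transfer[OF assms(3), of "k - 1"]
      cech_vanishes_product_of_spheres[OF that] that by simp
  then have "char_power_vanishes d"
    using char_power_vanishes_above[OF assms(1)] d by blast
  moreover have "f (antipode x) = t (f x)" if "x \<in> topspace (nsphere d)" for x
  proof -
    have "f x \<in> topspace X" using f that by (auto simp: continuous_map_def)
    then show ?thesis using feq[OF that] that by (simp add: t_def antipodal_action_def)
  qed
  ultimately show False
    using no_equivariant_map_if_char_power_vanishes[OF _ _ f] d by fastforce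
qed simp

end
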